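(* For a Tychonoff space $Z$, the following assertions are equivalent: (i) $Z$ is a $k_{\mathbb{R}}$-space; (ii) each linear form $\chi$ on $M_c(Z)$ which is continuous (for the weak$^\ast$ topology) on each weak$^\ast$ compact subset of the form $$B_{C(K)^\ast}= \{\mu\in M_c(Z): \mathrm{supp}(\mu)\subseteq K \text{ and } \|\mu\|\leq 1\},$$ where $K$ ranges over the compact subsets of $Z$, is weak$^\ast$ continuous (i.e. $\chi\in C(Z)$, meaning that there is $f\in C(Z)$ with $\chi(\mu)=\int f\,d\mu$ for all $\mu\in M_c(Z)$).
   Context: $C(Z)$ is the space of all continuous real-valued functions on $Z$, and $C_k(Z)$ is $C(Z)$ with the compact-open topology. $M_c(Z)$ denotes the space of all (finite, real-valued signed) regular Borel measures on $Z$ with compact support; it is the dual space of $C_k(Z)$ via $\langle \mu,f\rangle=\int f\,d\mu$. The weak$^\ast$ topology on $M_c(Z)$ is the topology of pointwise convergence on $C(Z)$; $\mathrm{supp}(\mu)$ is the support of $\mu$ and $\|\mu\|$ its total variation norm. A function $f:Z\to\mathbb{R}$ is $k$-continuous if its restriction to every compact subset of $Z$ is continuous; $Z$ is a $k_{\mathbb{R}}$-space if every $k$-continuous function $f:Z\to\mathbb{R}$ is continuous. *)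

theory Defs
  imports "HOL-Analysis.Analysis"
begin

definition tychonoff_space :: "'a topology \<Rightarrow> bool" where
  "tychonoff_space Z \<longleftrightarrow> completely_regular_space Z \<and> Hausdorff_space Z"

definition k_continuous :: "'a topology \<Rightarrow> ('a \<Rightarrow> real) \<Rightarrow> bool" where
  "k_continuous Z f \<longleftrightarrow>
     (\<forall>K. compactin Z K \<longrightarrow> continuous_map (subtopology Z K) euclideanreal f)"

definition kR_space :: "'a topology \<Rightarrow> bool" where
  "kR_space Z \<longleftrightarrow> (\<forall>f. k_continuous Z f \<longrightarrow> continuous_map Z euclideanreal f)"

definition borel_on :: "'a topology \<Rightarrow> 'a measure" where
  "borel_on Z = sigma (topspace Z) {U. openin Z U}"

text \<open>A finite signed Borel measure is a countably additive real-valued set function on the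
  Borel sets. It is extended by 0 to the other sets, so that two measures are equal as HOL
  functions iff they agree on the Borel sets.\<close>

definition signed_borel_measure :: "'a topology \<Rightarrow> ('a set \<Rightarrow> real) \<Rightarrow> bool" where
  "signed_borel_measure Z \<mu> \<longleftrightarrow>
     \<mu> {} = 0 \<and>
     (\<forall>A::nat \<Rightarrow> 'a set. range A \<subseteq> sets (borel_on Z) \<and> disjoint_family A
        \<longrightarrow> (\<lambda>i. \<mu> (A i)) sums \<mu> (\<Union>i. A i)) \<and>
     (\<forall>A. A \<notin> sets (borel_on Z) \<longrightarrow> \<mu> A = 0)"

definition total_variation :: "'a topology \<Rightarrow> ('a set \<Rightarrow> real) \<Rightarrow> 'a set \<Rightarrow> ennreal" where
  "total_variation Z \<mu> A =
     (SUP P \<in> {P. finite P \<and> P \<subseteq> sets (borel_on Z) \<and> disjoint P \<and> \<Union>P = A}.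
        \<Sum>B\<in>P. ennreal \<bar>\<mu> B\<bar>)"

definition tv_norm :: "'a topology \<Rightarrow> ('a set \<Rightarrow> real) \<Rightarrow> ennreal" where
  "tv_norm Z \<mu> = total_variation Z \<mu> (topspace Z)"

text \<open>Regularity is meant in the Radon sense: inner approximation is by compact sets. With
  closed sets instead, \<open>\<mu>\<close> need not be concentrated on its support.\<close>

definition regular_signed_measure :: "'a topology \<Rightarrow> ('a set \<Rightarrow> real) \<Rightarrow> bool" where
  "regular_signed_measure Z \<mu> \<longleftrightarrow>
     (\<forall>A \<in> sets (borel_on Z). \<forall>\<epsilon>>0. \<exists>K U. compactin Z K \<and> openin Z U \<and> K \<subseteq> A \<and> A \<subseteq> U
        \<and> total_variation Z \<mu> (U - K) < \<epsilon>)"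

definition msupport :: "'a topology \<Rightarrow> ('a set \<Rightarrow> real) \<Rightarrow> 'a set" where
  "msupport Z \<mu> = topspace Z - \<Union>{U. openin Z U \<and> total_variation Z \<mu> U = 0}"

definition Mc :: "'a topology \<Rightarrow> ('a set \<Rightarrow> real) set" where
  "Mc Z = {\<mu>. signed_borel_measure Z \<mu> \<and> regular_signed_measure Z \<mu>
              \<and> compactin Z (msupport Z \<mu>)}"

text \<open>The Jordan decomposition \<open>\<mu>\<^sup>+ = (\<bar>\<mu>\<bar> + \<mu>) / 2\<close>, \<open>\<mu>\<^sup>- = (\<bar>\<mu>\<bar> - \<mu>) / 2\<close>; the latter is the
  positive part of \<open>-\<mu>\<close>, as \<open>\<mu>\<close> and \<open>-\<mu>\<close> have the same total variation.\<close>

definition pos_part :: "'a topology \<Rightarrow> ('a set \<Rightarrow> real) \<Rightarrow> 'a measure" where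
  "pos_part Z \<mu> = measure_of (topspace Z) (sets (borel_on Z))
     (\<lambda>A. ennreal ((enn2real (total_variation Z \<mu> A) + \<mu> A) / 2))"

definition neg_part :: "'a topology \<Rightarrow> ('a set \<Rightarrow> real) \<Rightarrow> 'a measure" where
  "neg_part Z \<mu> = pos_part Z (\<lambda>A. - \<mu> A)"

definition signed_integral :: "'a topology \<Rightarrow> ('a set \<Rightarrow> real) \<Rightarrow> ('a \<Rightarrow> real) \<Rightarrow> real" where
  "signed_integral Z \<mu> f = (LINT x|pos_part Z \<mu>. f x) - (LINT x|neg_part Z \<mu>. f x)"

text \<open>The topology of pointwise convergence on \<open>C(Z)\<close>: the initial topology for the map
  sending \<open>\<mu>\<close> to the family of its integrals, indexed by the continuous functions.\<close>

definition weak_star :: "'a topology \<Rightarrow> ('a set \<Rightarrow> real) topology" where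
  "weak_star Z =
     pullback_topology (Mc Z)
       (\<lambda>\<mu>. \<lambda>f\<in>{f. continuous_map Z euclideanreal f}. signed_integral Z \<mu> f)
       (product_topology (\<lambda>_. euclideanreal) {f. continuous_map Z euclideanreal f})"

definition linear_form :: "'a topology \<Rightarrow> (('a set \<Rightarrow> real) \<Rightarrow> real) \<Rightarrow> bool" where
  "linear_form Z \<phi> \<longleftrightarrow>
     (\<forall>\<mu>\<in>Mc Z. \<forall>\<nu>\<in>Mc Z. \<phi> (\<lambda>A. \<mu> A + \<nu> A) = \<phi> \<mu> + \<phi> \<nu>) \<and>
     (\<forall>c. \<forall>\<mu>\<in>Mc Z. \<phi> (\<lambda>A. c * \<mu> A) = c * \<phi> \<mu>)"

definition dual_ball :: "'a topology \<Rightarrow> 'a set \<Rightarrow> ('a set \<Rightarrow> real) set" where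
  "dual_ball Z K = {\<mu> \<in> Mc Z. msupport Z \<mu> \<subseteq> K \<and> tv_norm Z \<mu> \<le> 1}"

end

theory Submission
  imports Defs
begin

text \<open>The point masses \<open>\<delta>\<^sub>x\<close> with \<open>x \<in> K\<close> lie in the dual ball of \<open>K\<close>, and \<open>x \<mapsto> \<delta>\<^sub>x\<close> is continuous.
  Hence a linear form \<open>\<phi>\<close> that is continuous on all dual balls yields a \<open>k\<close>-continuous function
  \<open>f x = \<phi> \<delta>\<^sub>x\<close>. If \<open>f\<close> is continuous, then \<open>\<phi>\<close> is integration of \<open>f\<close>: cutting \<open>K\<close> into finitely many Borel
  pieces \<open>B\<close> on which finitely many given functions are almost constant, with points \<open>x\<^sub>B \<in> B\<close>, the sum
  of the \<open>\<mu> B \<cdot> \<delta>\<close> at \<open>x\<^sub>B\<close> stays in the ball and approximates \<open>\<mu>\<close> weakly. Conversely a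
  \<open>k\<close>-continuous \<open>f\<close> can be integrated against each \<open>\<mu>\<close>, after a Tietze extension of its restriction to
  the support of \<open>\<mu>\<close>; this linear form is continuous on dual balls, and it sends \<open>\<delta>\<^sub>x\<close> to \<open>f x\<close>.\<close>

subsection \<open>The Borel sets\<close>

lemma space_borel_on [simp]: "space (borel_on Z) = topspace Z"
  unfolding borel_on_def using openin_subset by (subst space_measure_of) auto

lemma sets_borel_on_eq: "sets (borel_on Z) = sigma_sets (topspace Z) {U. openin Z U}"
  unfolding borel_on_def using openin_subset by (subst sets_measure_of) auto

lemma sigma_algebra_borel_on: "sigma_algebra (topspace Z) (sets (borel_on Z))"
  using sets.sigma_algebra_axioms[of "borel_on Z"] by simp

lemma openin_borel_on: "openin Z U \<Longrightarrow> U \<in> sets (borel_on Z)"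
  unfolding sets_borel_on_eq by auto

lemma closedin_borel_on: "closedin Z C \<Longrightarrow> C \<in> sets (borel_on Z)"
proof -
  assume C: "closedin Z C"
  then have "topspace Z - (topspace Z - C) \<in> sets (borel_on Z)"
    using sets.compl_sets[OF openin_borel_on, of Z "topspace Z - C"] by (auto simp: closedin_def)
  with C show ?thesis by (simp add: closedin_def double_diff)
qed

lemma compactin_borel_on: "Hausdorff_space Z \<Longrightarrow> compactin Z K \<Longrightarrow> K \<in> sets (borel_on Z)"
  using closedin_borel_on compactin_imp_closedin by blast

lemma continuous_map_borel_measurable:
  "continuous_map Z euclideanreal f \<Longrightarrow> f \<in> borel_measurable (borel_on Z)"
proof (rule borel_measurableI)
  fix S :: "real set"
  assume "continuous_map Z euclideanreal f" "open S"
  then have "openin Z {x \<in> topspace Z. f x \<in> S}" by (simp add: continuous_map)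
  moreover have "f -` S \<inter> space (borel_on Z) = {x \<in> topspace Z. f x \<in> S}" by auto
  ultimately show "f -` S \<inter> space (borel_on Z) \<in> sets (borel_on Z)"
    by (simp add: openin_borel_on)
qed

subsection \<open>Total variation\<close>

lemma signed_borel_measure_sums:
  assumes "signed_borel_measure Z \<mu>" "range A \<subseteq> sets (borel_on Z)" "disjoint_family A"
  shows "(\<lambda>i::nat. \<mu> (A i)) sums \<mu> (\<Union>i. A i)"
  using assms unfolding signed_borel_measure_def by blast

lemma signed_borel_measure_empty: "signed_borel_measure Z \<mu> \<Longrightarrow> \<mu> {} = 0"
  by (simp add: signed_borel_measure_def)

lemma total_variation_upper:
  assumes "finite P" "P \<subseteq> sets (borel_on Z)" "disjoint P" "\<Union>P = A"
  shows "(\<Sum>B\<in>P. ennreal \<bar>\<mu> B\<bar>) \<le> total_variation Z \<mu> A"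
  unfolding total_variation_def using assms by (intro SUP_upper) auto

lemma total_variation_least:
  assumes "\<And>P. finite P \<Longrightarrow> P \<subseteq> sets (borel_on Z) \<Longrightarrow> disjoint P \<Longrightarrow> \<Union>P = A \<Longrightarrow>
             (\<Sum>B\<in>P. ennreal \<bar>\<mu> B\<bar>) \<le> c"
  shows "total_variation Z \<mu> A \<le> c"
  unfolding total_variation_def using assms by (intro SUP_least) auto

text \<open>The supremum runs over sets of pieces, so an indexed family must be made injective
  before it counts as a partition. Disjointness lets only empty members repeat, and these contribute
  0.\<close>

lemma total_variation_upper_family:
  assumes "signed_borel_measure Z \<mu>" "finite I" "disjoint_family_on X I"
    "\<And>i. i \<in> I \<Longrightarrow> X i \<in> sets (borel_on Z)" "(\<Union>i\<in>I. X i) = A"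
  shows "(\<Sum>i\<in>I. ennreal \<bar>\<mu> (X i)\<bar>) \<le> total_variation Z \<mu> A"
proof -
  let ?J = "{i\<in>I. X i \<noteq> {}}"
  have inj: "inj_on X ?J"
  proof (rule inj_onI)
    fix i j assume ij: "i \<in> ?J" "j \<in> ?J" "X i = X j"
    then show "i = j" using disjoint_family_onD[OF assms(3), of i j] by auto
  qed
  have "(\<Sum>i\<in>I. ennreal \<bar>\<mu> (X i)\<bar>) = (\<Sum>i\<in>?J. ennreal \<bar>\<mu> (X i)\<bar>)"
    using assms(1,2) by (intro sum.mono_neutral_right) (auto simp: signed_borel_measure_empty)
  also have "\<dots> = (\<Sum>B\<in>X`?J. ennreal \<bar>\<mu> B\<bar>)"
    using inj by (simp add: sum.reindex)
  also have "\<dots> \<le> total_variation Z \<mu> A"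
  proof (rule total_variation_upper)
    show "disjoint (X ` ?J)"
      using disjoint_family_onD[OF assms(3)] unfolding pairwise_def disjnt_def by blast
  qed (use assms in auto)
  finally show ?thesis .
qed

text \<open>A partition of \<open>A\<close> becomes a partition of \<open>B\<close> by adding the
  piece \<open>B - A\<close>. If some admissible partition of \<open>A\<close> exists, then
  \<open>A\<close> is Borel, so the added piece is Borel too.\<close>

lemma total_variation_mono:
  assumes "A \<subseteq> B" "B \<in> sets (borel_on Z)"
  shows "total_variation Z \<mu> A \<le> total_variation Z \<mu> B"
proof (rule total_variation_least)
  fix P assume P: "finite P" "P \<subseteq> sets (borel_on Z)" "disjoint P" "\<Union>P = A"
  then have "A \<in> sets (borel_on Z)" by auto
  have "(\<Sum>B\<in>P. ennreal \<bar>\<mu> B\<bar>) \<le> (\<Sum>B\<in>insert (B - A) P. ennreal \<bar>\<mu> B\<bar>)"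
    using P(1) by (intro sum_mono2) auto
  also have "\<dots> \<le> total_variation Z \<mu> B"
  proof (rule total_variation_upper)
    show "disjoint (insert (B - A) P)"
      using P by (auto simp: pairwise_insert disjnt_def)
  qed (use P assms \<open>A \<in> sets (borel_on Z)\<close> in auto)
  finally show "(\<Sum>B\<in>P. ennreal \<bar>\<mu> B\<bar>) \<le> total_variation Z \<mu> B" .
qed

lemma total_variation_ge_abs:
  assumes "A \<in> sets (borel_on Z)"
  shows "ennreal \<bar>\<mu> A\<bar> \<le> total_variation Z \<mu> A"
  using total_variation_upper[of "{A}" Z A \<mu>] assms by simp

text \<open>A partition of \<open>A\<close> and one of \<open>B\<close> together partition the
  union. They can share only the empty set, whose value is 0, so their sums simply add up.\<close>

lemma total_variation_superadditive:
  assumes "A \<in> sets (borel_on Z)" "B \<in> sets (borel_on Z)" "A \<inter> B = {}" "\<mu> {} = 0"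
  shows "total_variation Z \<mu> A + total_variation Z \<mu> B \<le> total_variation Z \<mu> (A \<union> B)"
proof -
  let ?S = "\<lambda>A. {P. finite P \<and> P \<subseteq> sets (borel_on Z) \<and> disjoint P \<and> \<Union>P = A}"
  let ?f = "\<lambda>P. \<Sum>B\<in>P. ennreal \<bar>\<mu> B\<bar>"
  have "{A} \<in> ?S A" "{B} \<in> ?S B"
    using assms(1,2) by simp_all
  \<comment> \<open>Pulling the two suprema out of the sum at the end is possible only over
    non-empty index sets.\<close>
  then have ne: "?S A \<noteq> {}" "?S B \<noteq> {}"
    using empty_iff by metis+
  have "?f P + ?f Q \<le> total_variation Z \<mu> (A \<union> B)" if P: "P \<in> ?S A" and Q: "Q \<in> ?S B" for P Q
  proof -
    have fin: "finite P" "finite Q" and PQ: "\<Union>P = A" "\<Union>Q = B" "disjoint P" "disjoint Q"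
      and sub: "P \<subseteq> sets (borel_on Z)" "Q \<subseteq> sets (borel_on Z)"
      using P Q by simp_all
    have "?f (P \<union> Q) + ?f (P \<inter> Q) = ?f P + ?f Q"
      using fin by (rule sum.union_inter)
    moreover have "P \<inter> Q \<subseteq> {{}}" using PQ(1,2) assms(3) by blast
    then have "?f (P \<inter> Q) = 0" using assms(4) by (intro sum.neutral) auto
    moreover have "?f (P \<union> Q) \<le> total_variation Z \<mu> (A \<union> B)"
    proof (rule total_variation_upper)
      show "disjoint (P \<union> Q)"
        using PQ(1,2) assms(3) by (intro disjoint_union[OF PQ(3,4)]) blast
      show "\<Union>(P \<union> Q) = A \<union> B" using PQ by blast
    qed (use fin sub in simp_all)
    ultimately show ?thesis by simp
  qed
  then show ?thesis
    unfolding total_variation_def[of Z \<mu> A] total_variation_def[of Z \<mu> B]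
      ennreal_SUP_add_right[OF ne(2)] ennreal_SUP_add_left[OF ne(1), symmetric]
    by (intro SUP_least)
qed

lemma total_variation_empty:
  fixes \<mu> :: "'a set \<Rightarrow> real"
  shows "\<mu> {} = 0 \<Longrightarrow> total_variation Z \<mu> {} = 0"
proof -
  assume \<mu>: "\<mu> {} = 0"
  have "total_variation Z \<mu> {} \<le> 0"
  proof (rule total_variation_least)
    fix P :: "'a set set" assume "\<Union>P = {}"
    then have "\<forall>B\<in>P. ennreal \<bar>\<mu> B\<bar> = 0" using \<mu> by auto
    then show "(\<Sum>B\<in>P. ennreal \<bar>\<mu> B\<bar>) \<le> 0" using sum.neutral by (metis order_refl)
  qed
  then show ?thesis by simp
qed

text \<open>One inequality is the limit of finite superadditivity. For the other, a partition of the
  union is cut by every \<open>A i\<close>: countable additivity of \<mu> on each piece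
  \<open>B\<close> bounds its value by a series over \<open>i\<close>, and exchanging the two sums
  leaves a partition of each \<open>A i\<close>.\<close>

lemma total_variation_countably_additive:
  assumes \<mu>: "signed_borel_measure Z \<mu>"
  shows "countably_additive (sets (borel_on Z)) (total_variation Z \<mu>)"
  unfolding countably_additive_def
proof (intro allI impI antisym)
  fix A :: "nat \<Rightarrow> 'a set"
  assume A: "range A \<subseteq> sets (borel_on Z)" "disjoint_family A" "(\<Union>i. A i) \<in> sets (borel_on Z)"
  have As: "A i \<in> sets (borel_on Z)" for i using A(1) by blast
  have \<mu>0: "\<mu> {} = 0" using \<mu> by (rule signed_borel_measure_empty)
  have "(\<Sum>i<n. total_variation Z \<mu> (A i)) \<le> total_variation Z \<mu> (\<Union>i<n. A i)" for n
  proof (induction n)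
    case (Suc n)
    have "(\<Sum>i<Suc n. total_variation Z \<mu> (A i))
        \<le> total_variation Z \<mu> (\<Union>i<n. A i) + total_variation Z \<mu> (A n)"
      using Suc by (simp add: add_right_mono)
    also have "\<dots> \<le> total_variation Z \<mu> ((\<Union>i<n. A i) \<union> A n)"
    proof (rule total_variation_superadditive)
      show "A n \<in> sets (borel_on Z)" "\<mu> {} = 0" by (rule As, rule \<mu>0)
      show "(\<Union>i<n. A i) \<in> sets (borel_on Z)" using As by (intro sets.finite_UN) simp_all
      have "A i \<inter> A n = {}" if "i < n" for i
        using disjoint_family_onD[OF A(2), of i n] that by simp
      then show "(\<Union>i<n. A i) \<inter> A n = {}" by blast
    qed
    finally show ?case by (simp add: lessThan_Suc Un_commute)
  qed simp
  also have "total_variation Z \<mu> (\<Union>i<n. A i) \<le> total_variation Z \<mu> (\<Union>i. A i)" for n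
    by (rule total_variation_mono[OF _ A(3)]) blast
  finally show "(\<Sum>i. total_variation Z \<mu> (A i)) \<le> total_variation Z \<mu> (\<Union>i. A i)"
    by (intro suminf_le_const) auto
  show "total_variation Z \<mu> (\<Union>i. A i) \<le> (\<Sum>i. total_variation Z \<mu> (A i))"
  proof (rule total_variation_least)
    fix P assume P: "finite P" "P \<subseteq> sets (borel_on Z)" "disjoint P" "\<Union>P = (\<Union>i. A i)"
    have "(\<Sum>B\<in>P. ennreal \<bar>\<mu> B\<bar>) \<le> (\<Sum>B\<in>P. \<Sum>i. ennreal \<bar>\<mu> (B \<inter> A i)\<bar>)"
    proof (rule sum_mono)
      fix B assume B: "B \<in> P"
      have "(\<lambda>i. \<mu> (B \<inter> A i)) sums \<mu> (\<Union>i. B \<inter> A i)"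
      proof (rule signed_borel_measure_sums[OF \<mu>])
        show "range (\<lambda>i. B \<inter> A i) \<subseteq> sets (borel_on Z)" using As B P(2) by blast
        show "disjoint_family (\<lambda>i. B \<inter> A i)"
          using A(2) unfolding disjoint_family_on_def by blast
      qed
      moreover have "(\<Union>i. B \<inter> A i) = B" using B P(4) by blast
      ultimately have s: "(\<lambda>i. \<mu> (B \<inter> A i)) sums \<mu> B" by simp
      show "ennreal \<bar>\<mu> B\<bar> \<le> (\<Sum>i. ennreal \<bar>\<mu> (B \<inter> A i)\<bar>)"
      \<comment> \<open>Plain convergence of the signed series does not by itself give absolute
        convergence, hence the case split: if absolute convergence failed, the right-hand side would
        be infinite.\<close>
      proof (cases "summable (\<lambda>i. \<bar>\<mu> (B \<inter> A i)\<bar>)")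
        case True
        then show ?thesis
          using s summable_rabs[OF True] by (simp add: suminf_ennreal2 sums_iff ennreal_leI)
      next
        case False
        have "(\<Sum>i. ennreal \<bar>\<mu> (B \<inter> A i)\<bar>) = top"
        proof (rule ccontr)
          assume "(\<Sum>i. ennreal \<bar>\<mu> (B \<inter> A i)\<bar>) \<noteq> top"
          then have "summable (\<lambda>i. \<bar>\<mu> (B \<inter> A i)\<bar>)"
            by (rule summable_suminf_not_top[rotated]) (rule abs_ge_zero)
          with False show False ..
        qed
        then show ?thesis by simp
      qed
    qed
    also have "\<dots> = (\<Sum>i. \<Sum>B\<in>P. ennreal \<bar>\<mu> (B \<inter> A i)\<bar>)"
      by (rule suminf_sum[symmetric]) (rule summableI)
    also have "\<dots> \<le> (\<Sum>i. total_variation Z \<mu> (A i))"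
    proof (intro suminf_le)
      fix i
      show "(\<Sum>B\<in>P. ennreal \<bar>\<mu> (B \<inter> A i)\<bar>) \<le> total_variation Z \<mu> (A i)"
      proof (rule total_variation_upper_family[OF \<mu> P(1)])
        show "disjoint_family_on (\<lambda>B. B \<inter> A i) P"
          using P(3) unfolding disjoint_family_on_def pairwise_def disjnt_def by blast
        show "B \<inter> A i \<in> sets (borel_on Z)" if "B \<in> P" for B using As P(2) that by blast
        show "(\<Union>B\<in>P. B \<inter> A i) = A i" using P(4) by blast
      qed
    qed (rule summableI)+
    finally show "(\<Sum>B\<in>P. ennreal \<bar>\<mu> B\<bar>) \<le> (\<Sum>i. total_variation Z \<mu> (A i))" .
  qed
qed

section \<open>The variation as a measure\<close>

definition tv_measure :: "'a topology \<Rightarrow> ('a set \<Rightarrow> real) \<Rightarrow> 'a measure" where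
  "tv_measure Z \<mu> = measure_of (topspace Z) (sets (borel_on Z)) (total_variation Z \<mu>)"

lemma sets_tv_measure [simp]: "sets (tv_measure Z \<mu>) = sets (borel_on Z)"
  unfolding tv_measure_def
  using sigma_algebra.sets_measure_of_eq[OF sigma_algebra_borel_on] by blast

lemma emeasure_tv_measure:
  assumes "signed_borel_measure Z \<mu>" "A \<in> sets (borel_on Z)"
  shows "emeasure (tv_measure Z \<mu>) A = total_variation Z \<mu> A"
  using assms unfolding tv_measure_def
  by (intro emeasure_measure_of_sigma sigma_algebra_borel_on total_variation_countably_additive)
     (auto simp: positive_def total_variation_empty signed_borel_measure_empty)

lemma total_variation_subadditive:
  assumes "signed_borel_measure Z \<mu>" "A \<in> sets (borel_on Z)" "B \<in> sets (borel_on Z)"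
  shows "total_variation Z \<mu> (A \<union> B) \<le> total_variation Z \<mu> A + total_variation Z \<mu> B"
  using emeasure_subadditive[of A "tv_measure Z \<mu>" B] assms
  by (simp add: emeasure_tv_measure)

lemma total_variation_sum_le:
  assumes \<mu>: "signed_borel_measure Z \<mu>" and "finite F" "F \<subseteq> sets (borel_on Z)" "A \<subseteq> \<Union>F"
  shows "total_variation Z \<mu> A \<le> (\<Sum>U\<in>F. total_variation Z \<mu> U)"
proof -
  have "total_variation Z \<mu> A \<le> total_variation Z \<mu> (\<Union>F)"
    using assms by (intro total_variation_mono) auto
  also have "\<dots> \<le> (\<Sum>U\<in>F. total_variation Z \<mu> U)"
    using emeasure_subadditive_finite[of F "\<lambda>U. U" "tv_measure Z \<mu>"] assms(2,3)
      emeasure_tv_measure[OF \<mu> sets.finite_Union[OF assms(2,3)]]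
    by (simp add: emeasure_tv_measure[OF \<mu>] subset_eq)
  finally show ?thesis .
qed

section \<open>Consequences of regularity: finiteness and concentration on the support\<close>

lemma regular_signed_measureE:
  assumes "regular_signed_measure Z \<mu>" "A \<in> sets (borel_on Z)" "\<epsilon> > 0"
  obtains K U where "compactin Z K" "openin Z U" "K \<subseteq> A" "A \<subseteq> U" "total_variation Z \<mu> (U - K) < \<epsilon>"
  using assms(1)[unfolded regular_signed_measure_def, rule_format, OF assms(2,3)] that
  by (elim exE conjE)

text \<open>Outer regularity at \<open>{x}\<close> bounds the variation of some neighbourhood of \<open>x\<close>; compactness does the
  rest.\<close>

lemma regular_total_variation_finite:
  assumes \<mu>: "signed_borel_measure Z \<mu>" and reg: "regular_signed_measure Z \<mu>"
    and H: "Hausdorff_space Z"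
  shows "total_variation Z \<mu> A < \<infinity>"
proof -
  have "\<exists>U. openin Z U \<and> x \<in> U \<and> total_variation Z \<mu> U < \<infinity>" if x: "x \<in> topspace Z" for x
  proof -
    have X: "{x} \<in> sets (borel_on Z)" using H x by (simp add: compactin_borel_on)
    obtain K U where KU: "compactin Z K" "openin Z U" "K \<subseteq> {x}" "{x} \<subseteq> U"
        "total_variation Z \<mu> (U - K) < 1"
      by (rule regular_signed_measureE[OF reg X zero_less_one])
    \<comment> \<open>A partition of a singleton consists of that singleton and possibly the empty
      set, so its variation is a single real value.\<close>
    have "total_variation Z \<mu> {x} \<le> ennreal \<bar>\<mu> {x}\<bar>"
    proof (rule total_variation_least)
      fix P assume "\<Union>P = {x}"
      then have "(\<Sum>B\<in>P. ennreal \<bar>\<mu> B\<bar>) \<le> (\<Sum>B\<in>{{}, {x}}. ennreal \<bar>\<mu> B\<bar>)"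
        by (intro sum_mono2) auto
      then show "(\<Sum>B\<in>P. ennreal \<bar>\<mu> B\<bar>) \<le> ennreal \<bar>\<mu> {x}\<bar>"
        using \<mu> by (simp add: signed_borel_measure_empty)
    qed
    then have fx: "total_variation Z \<mu> {x} < \<infinity>"
      using le_less_trans by fastforce
    have UK: "U - K \<in> sets (borel_on Z)"
      using KU openin_borel_on compactin_borel_on[OF H] by (intro sets.Diff)
    have "total_variation Z \<mu> U \<le> total_variation Z \<mu> ((U - K) \<union> {x})"
      using KU(3) sets.Un[OF UK X] by (intro total_variation_mono) auto
    also have "\<dots> \<le> total_variation Z \<mu> (U - K) + total_variation Z \<mu> {x}"
      using UK X by (rule total_variation_subadditive[OF \<mu>])
    also have "\<dots> < \<infinity>"
      using KU(5) fx by (metis ennreal_add_eq_top ennreal_one_less_top infinity_ennreal_def less_top order_less_trans)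
    finally show ?thesis using KU by blast
  qed
  then obtain u where u: "\<And>x. x \<in> topspace Z \<Longrightarrow> openin Z (u x) \<and> x \<in> u x \<and> total_variation Z \<mu> (u x) < \<infinity>"
    by metis
  \<comment> \<open>Regularity applied to the whole space gives a compact \<open>K\<close> whose
    complement has variation below 1, so only \<open>K\<close> has to be covered by neighbourhoods
    of finite variation.\<close>
  obtain K U where KU: "compactin Z K" "openin Z U" "K \<subseteq> topspace Z" "topspace Z \<subseteq> U"
      "total_variation Z \<mu> (U - K) < 1"
    by (rule regular_signed_measureE[OF reg openin_borel_on[OF openin_topspace] zero_less_one])
  have "\<exists>F. finite F \<and> F \<subseteq> u ` topspace Z \<and> K \<subseteq> \<Union>F"
    using u KU(3) by (intro compactinD[OF KU(1)]) blast+
  then obtain F where F: "finite F" "F \<subseteq> u ` topspace Z" "K \<subseteq> \<Union>F" by blast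
  let ?T = "topspace Z"
  have U: "U = ?T" using KU openin_subset by blast
  have Fb: "F \<subseteq> sets (borel_on Z)" using F(2) u openin_borel_on by blast
  have "total_variation Z \<mu> ?T \<le> total_variation Z \<mu> ((?T - K) \<union> K)"
    using KU(3) by (simp add: Un_absorb2)
  also have "\<dots> \<le> total_variation Z \<mu> (?T - K) + total_variation Z \<mu> K"
    using compactin_borel_on[OF H KU(1)] openin_borel_on[OF openin_topspace]
    by (intro total_variation_subadditive[OF \<mu>] sets.Diff)
  also have "\<dots> \<le> total_variation Z \<mu> (?T - K) + (\<Sum>U\<in>F. total_variation Z \<mu> U)"
    using total_variation_sum_le[OF \<mu> F(1) Fb F(3)] by (rule add_left_mono)
  also have "\<dots> < \<infinity>"
  proof -
    have "total_variation Z \<mu> (?T - K) \<noteq> top" using KU(5) U by auto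
    moreover have "(\<Sum>U\<in>F. total_variation Z \<mu> U) < top"
      using F u by auto
    ultimately show ?thesis by (simp add: less_top)
  qed
  finally have T: "total_variation Z \<mu> ?T < \<infinity>" .
  show ?thesis
  proof (cases "A \<in> sets (borel_on Z)")
    case True
    then have "total_variation Z \<mu> A \<le> total_variation Z \<mu> ?T"
      using sets.sets_into_space[OF True] by (intro total_variation_mono) (auto simp: openin_borel_on)
    then show ?thesis using T by (rule le_less_trans)
  next
    case False
    \<comment> \<open>Finite unions of Borel sets are Borel, so a non-Borel set has no admissible
      partition and its variation is an empty supremum.\<close>
    have "total_variation Z \<mu> A \<le> 0"
    proof (rule total_variation_least)
      fix P assume "finite P" "P \<subseteq> sets (borel_on Z)" "\<Union>P = A"
      then have "A \<in> sets (borel_on Z)" using sets.finite_Union by blast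
      with False show "(\<Sum>B\<in>P. ennreal \<bar>\<mu> B\<bar>) \<le> 0" ..
    qed
    then show ?thesis by simp
  qed
qed

text \<open>The complement of the support is a union of null open sets, possibly uncountably many.
  Inner regularity replaces it, up to \<epsilon>, by a compact subset, and finitely many of the null
  sets cover that subset.\<close>

lemma regular_total_variation_outside_support:
  assumes \<mu>: "signed_borel_measure Z \<mu>" and reg: "regular_signed_measure Z \<mu>"
    and H: "Hausdorff_space Z"
  shows "total_variation Z \<mu> (topspace Z - msupport Z \<mu>) = 0"
proof -
  let ?N = "{U. openin Z U \<and> total_variation Z \<mu> U = 0}"
  define A where "A = topspace Z - msupport Z \<mu>"
  have A: "A = \<Union>?N" unfolding msupport_def A_def using openin_subset by blast
  have oA: "openin Z A" unfolding A by (intro openin_Union) auto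
  have "total_variation Z \<mu> A \<le> \<epsilon>" if "\<epsilon> > 0" for \<epsilon>
  proof -
    obtain K U where KU: "compactin Z K" "openin Z U" "K \<subseteq> A" "A \<subseteq> U"
        "total_variation Z \<mu> (U - K) < \<epsilon>"
      by (rule regular_signed_measureE[OF reg openin_borel_on[OF oA] \<open>\<epsilon> > 0\<close>])
    have "\<exists>F. finite F \<and> F \<subseteq> ?N \<and> K \<subseteq> \<Union>F"
      using KU(3) unfolding A by (intro compactinD[OF KU(1)]) blast+
    then obtain F where F: "finite F" "F \<subseteq> ?N" "K \<subseteq> \<Union>F" by blast
    have "total_variation Z \<mu> K \<le> (\<Sum>U\<in>F. total_variation Z \<mu> U)"
      using F openin_borel_on by (intro total_variation_sum_le[OF \<mu>]) auto
    also have "\<dots> = 0" using F by (intro sum.neutral) auto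
    finally have K0: "total_variation Z \<mu> K = 0" by simp
    have b: "K \<in> sets (borel_on Z)" "U - K \<in> sets (borel_on Z)"
      using compactin_borel_on[OF H KU(1)] openin_borel_on[OF KU(2)] by (simp_all add: sets.Diff)
    have "total_variation Z \<mu> A \<le> total_variation Z \<mu> ((U - K) \<union> K)"
      using KU(4) by (intro total_variation_mono sets.Un[OF b(2,1)]) blast
    also have "\<dots> \<le> total_variation Z \<mu> (U - K) + total_variation Z \<mu> K"
      by (rule total_variation_subadditive[OF \<mu> b(2,1)])
    finally show ?thesis using K0 KU(5) by simp
  qed
  then have "total_variation Z \<mu> A \<le> 0" by (rule dense_ge)
  then show ?thesis unfolding A_def by simp
qed

section \<open>Sums and multiples of signed measures\<close>

lemma total_variation_add_le:
  "total_variation Z (\<lambda>A. \<mu> A + \<nu> A) A \<le> total_variation Z \<mu> A + total_variation Z \<nu> A"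
proof (rule total_variation_least)
  fix P assume P: "finite P" "P \<subseteq> sets (borel_on Z)" "disjoint P" "\<Union>P = A"
  have "(\<Sum>B\<in>P. ennreal \<bar>\<mu> B + \<nu> B\<bar>) \<le> (\<Sum>B\<in>P. ennreal \<bar>\<mu> B\<bar> + ennreal \<bar>\<nu> B\<bar>)"
    by (intro sum_mono) (simp add: ennreal_leI flip: ennreal_plus)
  also have "\<dots> = (\<Sum>B\<in>P. ennreal \<bar>\<mu> B\<bar>) + (\<Sum>B\<in>P. ennreal \<bar>\<nu> B\<bar>)"
    by (rule sum.distrib)
  also have "\<dots> \<le> total_variation Z \<mu> A + total_variation Z \<nu> A"
    using P by (intro add_mono total_variation_upper)
  finally show "(\<Sum>B\<in>P. ennreal \<bar>\<mu> B + \<nu> B\<bar>) \<le> total_variation Z \<mu> A + total_variation Z \<nu> A" .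
qed

lemma total_variation_scale_le:
  "total_variation Z (\<lambda>A. c * \<mu> A) A \<le> ennreal \<bar>c\<bar> * total_variation Z \<mu> A"
proof (rule total_variation_least)
  fix P assume P: "finite P" "P \<subseteq> sets (borel_on Z)" "disjoint P" "\<Union>P = A"
  have "(\<Sum>B\<in>P. ennreal \<bar>c * \<mu> B\<bar>) = ennreal \<bar>c\<bar> * (\<Sum>B\<in>P. ennreal \<bar>\<mu> B\<bar>)"
    unfolding sum_distrib_left by (intro sum.cong refl) (simp add: abs_mult ennreal_mult)
  also have "\<dots> \<le> ennreal \<bar>c\<bar> * total_variation Z \<mu> A"
    using P by (intro mult_left_mono total_variation_upper) simp_all
  finally show "(\<Sum>B\<in>P. ennreal \<bar>c * \<mu> B\<bar>) \<le> ennreal \<bar>c\<bar> * total_variation Z \<mu> A" .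
qed

lemma total_variation_uminus: "total_variation Z (\<lambda>A. - \<mu> A) = total_variation Z \<mu>"
  unfolding total_variation_def by simp

lemma signed_borel_measureI:
  assumes "\<mu> {} = 0"
    "\<And>A::nat \<Rightarrow> 'a set. range A \<subseteq> sets (borel_on Z) \<Longrightarrow> disjoint_family A \<Longrightarrow>
       (\<lambda>i. \<mu> (A i)) sums \<mu> (\<Union>i. A i)"
    "\<And>A. A \<notin> sets (borel_on Z) \<Longrightarrow> \<mu> A = 0"
  shows "signed_borel_measure Z \<mu>"
  unfolding signed_borel_measure_def using assms by simp

lemma signed_borel_measure_outside:
  "signed_borel_measure Z \<mu> \<Longrightarrow> A \<notin> sets (borel_on Z) \<Longrightarrow> \<mu> A = 0"
  by (simp add: signed_borel_measure_def)

lemma signed_borel_measure_add: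
  assumes "signed_borel_measure Z \<mu>" "signed_borel_measure Z \<nu>"
  shows "signed_borel_measure Z (\<lambda>A. \<mu> A + \<nu> A)"
  using signed_borel_measure_sums[OF assms(1)] signed_borel_measure_sums[OF assms(2)]
  by (intro signed_borel_measureI sums_add)
     (simp_all add: signed_borel_measure_empty[OF assms(1)] signed_borel_measure_empty[OF assms(2)]
       signed_borel_measure_outside[OF assms(1)] signed_borel_measure_outside[OF assms(2)])

lemma signed_borel_measure_scale:
  assumes "signed_borel_measure Z \<mu>"
  shows "signed_borel_measure Z (\<lambda>A. c * \<mu> A)"
  using signed_borel_measure_sums[OF assms]
  by (intro signed_borel_measureI sums_mult)
     (simp_all add: signed_borel_measure_empty[OF assms] signed_borel_measure_outside[OF assms])

lemma signed_borel_measure_uminus: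
  assumes "signed_borel_measure Z \<mu>"
  shows "signed_borel_measure Z (\<lambda>A. - \<mu> A)"
  using signed_borel_measure_scale[OF assms, of "-1"] by simp

subsection \<open>Integration against signed measures\<close>

lemma sets_pos_part [simp]: "sets (pos_part Z \<mu>) = sets (borel_on Z)"
  unfolding pos_part_def
  using sigma_algebra.sets_measure_of_eq[OF sigma_algebra_borel_on] by blast

lemma space_pos_part [simp]: "space (pos_part Z \<mu>) = topspace Z"
  using sets_eq_imp_space_eq[OF sets_pos_part] by simp

lemma space_tv_measure [simp]: "space (tv_measure Z \<mu>) = topspace Z"
  using sets_eq_imp_space_eq[OF sets_tv_measure] by simp

lemma topspace_borel_on [simp]: "topspace Z \<in> sets (borel_on Z)"
  by (simp add: openin_borel_on)

lemma total_variation_finite_subset: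
  assumes "total_variation Z \<mu> (topspace Z) < \<infinity>" "A \<in> sets (borel_on Z)"
  shows "total_variation Z \<mu> A < \<infinity>"
proof -
  have "total_variation Z \<mu> A \<le> total_variation Z \<mu> (topspace Z)"
    using sets.sets_into_space[OF assms(2)] by (intro total_variation_mono) simp_all
  then show ?thesis using assms(1) by (rule le_less_trans)
qed

text \<open>Finiteness matters in passing to the reals, since \<open>enn2real\<close> sends infinity
  to 0.\<close>

lemma abs_le_total_variation:
  assumes "total_variation Z \<mu> (topspace Z) < \<infinity>" "A \<in> sets (borel_on Z)"
  shows "\<bar>\<mu> A\<bar> \<le> enn2real (total_variation Z \<mu> A)"
proof -
  have "enn2real (ennreal \<bar>\<mu> A\<bar>) \<le> enn2real (total_variation Z \<mu> A)"
    using total_variation_ge_abs[OF assms(2)] total_variation_finite_subset[OF assms]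
    by (intro enn2real_mono) simp_all
  then show ?thesis by simp
qed

lemma total_variation_sums:
  assumes \<mu>: "signed_borel_measure Z \<mu>" and fin: "total_variation Z \<mu> (topspace Z) < \<infinity>"
    and A: "range A \<subseteq> sets (borel_on Z)" "disjoint_family (A :: nat \<Rightarrow> 'a set)"
  shows "(\<lambda>i. enn2real (total_variation Z \<mu> (A i))) sums enn2real (total_variation Z \<mu> (\<Union>i. A i))"
proof -
  interpret finite_measure "tv_measure Z \<mu>"
    using fin by (intro finite_measureI) (simp add: emeasure_tv_measure[OF \<mu>])
  have m: "measure (tv_measure Z \<mu>) B = enn2real (total_variation Z \<mu> B)"
    if "B \<in> sets (borel_on Z)" for B
    using emeasure_tv_measure[OF \<mu> that] by (simp add: measure_def)
  have "A i \<in> sets (borel_on Z)" for i using A(1) by blast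
  moreover have "(\<Union>i. A i) \<in> sets (borel_on Z)" using A(1) by (intro sets.countable_UN)
  ultimately show ?thesis using finite_measure_UNION[of A] A by (simp add: m)
qed

text \<open>\<open>measure_of\<close> yields the prescribed values only if they form a measure. They
  are non-negative because the variation dominates the absolute value of \<mu>, and they are
  countably additive because, with finite variation, both summands have convergent real
  series.\<close>

lemma emeasure_pos_part:
  assumes \<mu>: "signed_borel_measure Z \<mu>" and fin: "total_variation Z \<mu> (topspace Z) < \<infinity>"
    and A: "A \<in> sets (borel_on Z)"
  shows "emeasure (pos_part Z \<mu>) A = ennreal ((enn2real (total_variation Z \<mu> A) + \<mu> A) / 2)"
  unfolding pos_part_def
proof (rule emeasure_measure_of_sigma[OF sigma_algebra_borel_on _ _ A])
  let ?p = "\<lambda>A. (enn2real (total_variation Z \<mu> A) + \<mu> A) / 2"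
  have \<mu>0: "\<mu> {} = 0" using \<mu> by (rule signed_borel_measure_empty)
  show "positive (sets (borel_on Z)) (\<lambda>A. ennreal (?p A))"
    unfolding positive_def by (simp add: \<mu>0 total_variation_empty)
  show "countably_additive (sets (borel_on Z)) (\<lambda>A. ennreal (?p A))"
    unfolding countably_additive_def
  proof (intro allI impI)
    fix A :: "nat \<Rightarrow> 'a set"
    assume A: "range A \<subseteq> sets (borel_on Z)" "disjoint_family A" "(\<Union>i. A i) \<in> sets (borel_on Z)"
    show "(\<Sum>i. ennreal (?p (A i))) = ennreal (?p (\<Union>i. A i))"
    proof (rule suminf_ennreal_eq)
      fix i
      have "A i \<in> sets (borel_on Z)" using A(1) by blast
      then show "0 \<le> ?p (A i)" using abs_le_total_variation[OF fin, of "A i"] by simp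
    next
      show "(\<lambda>i. ?p (A i)) sums ?p (\<Union>i. A i)"
        using A by (intro sums_divide sums_add total_variation_sums[OF \<mu> fin] signed_borel_measure_sums[OF \<mu>]) simp_all
    qed
  qed
qed

lemma measure_pos_part:
  assumes "signed_borel_measure Z \<mu>" "total_variation Z \<mu> (topspace Z) < \<infinity>" "A \<in> sets (borel_on Z)"
  shows "measure (pos_part Z \<mu>) A = (enn2real (total_variation Z \<mu> A) + \<mu> A) / 2"
  using emeasure_pos_part[OF assms] abs_le_total_variation[OF assms(2,3)] by (simp add: measure_def)

lemma finite_measure_pos_part:
  assumes "signed_borel_measure Z \<mu>" "total_variation Z \<mu> (topspace Z) < \<infinity>"
  shows "finite_measure (pos_part Z \<mu>)"
  by (rule finite_measureI) (simp add: emeasure_pos_part[OF assms])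

section \<open>Approximation of integrals by finite step sums\<close>

lemma (in finite_measure) integral_step_approx:
  fixes f :: "'a \<Rightarrow> real"
  assumes S: "S \<in> sets M" "measure M (space M - S) = 0"
    and P: "finite P" "P \<subseteq> sets M" "disjoint P" "\<Union>P = S"
    and f: "f \<in> borel_measurable M" and c: "\<And>B x. B \<in> P \<Longrightarrow> x \<in> B \<Longrightarrow> \<bar>f x - c B\<bar> \<le> e"
  shows "\<bar>(LINT x|M. f x) - (\<Sum>B\<in>P. c B * measure M B)\<bar> \<le> e * measure M (space M)"
proof -
  \<comment> \<open>Since the pieces are disjoint, \<open>s\<close> takes the value
    \<open>c B\<close> on \<open>B\<close>. As \<open>S\<close> carries all the mass,
    \<open>s\<close> is within \<open>e\<close> of \<open>f\<close> almost everywhere.\<close>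
  define s where "s x = (\<Sum>B\<in>P. c B * indicator B x)" for x
  have sB: "s x = c B" if "B \<in> P" "x \<in> B" for B x
  proof -
    have "s x = (\<Sum>C\<in>{B}. c C * indicator C x)"
      unfolding s_def
    proof (rule sum.mono_neutral_right[OF P(1)])
      have "x \<notin> C" if "C \<in> P - {B}" for C
        using that \<open>B \<in> P\<close> \<open>x \<in> B\<close> P(3) unfolding pairwise_def disjnt_def by blast
      then show "\<forall>C\<in>P - {B}. c C * indicator C x = 0" by simp
    qed (use that in simp)
    then show ?thesis using that by simp
  qed
  have AE: "AE x in M. x \<in> S"
  proof (rule AE_I)
    show "{x \<in> space M. x \<notin> S} \<subseteq> space M - S" by blast
    show "emeasure M (space M - S) = 0" using S by (simp add: emeasure_eq_measure)
  qed (use S in simp)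
  have AEs: "AE x in M. \<bar>f x - s x\<bar> \<le> e"
    using AE
  proof eventually_elim
    case (elim x)
    then obtain B where "B \<in> P" "x \<in> B" using P(4) by blast
    then show ?case using c sB by simp
  qed
  have int_ind: "integrable M (\<lambda>x. c B * indicator B x)" if "B \<in> P" for B
    using that P(2) by (intro integrable_mult_right integrable_real_indicator)
      (auto simp: emeasure_eq_measure)
  then have ints: "integrable M s" unfolding s_def by (rule Bochner_Integration.integrable_sum)
  \<comment> \<open>Integrability of \<open>f\<close> is derived, not assumed: the difference is
    bounded almost everywhere on a finite measure space, and \<open>s\<close> is integrable.\<close>
  have "integrable M (\<lambda>x. f x - s x)"
    using AEs f ints by (intro integrable_const_bound[of _ e]) auto
  from Bochner_Integration.integrable_add[OF this ints] have intf: "integrable M f" by simp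
  have "(LINT x|M. s x) = (\<Sum>B\<in>P. LINT x|M. c B * indicator B x)"
    unfolding s_def using int_ind by (rule Bochner_Integration.integral_sum)
  also have "\<dots> = (\<Sum>B\<in>P. c B * measure M B)"
    using P(2) sets.sets_into_space by (intro sum.cong refl) (auto simp: Int_absorb1)
  finally have "(LINT x|M. f x) - (\<Sum>B\<in>P. c B * measure M B) = (LINT x|M. f x - s x)"
    using intf ints by simp
  also have "\<bar>\<dots>\<bar> \<le> (LINT x|M. \<bar>f x - s x\<bar>)" by (rule integral_abs_bound)
  also have "\<dots> \<le> (LINT x|M. e)"
    using AEs intf ints by (intro integral_mono_AE) simp_all
  finally show ?thesis by (simp add: mult.commute)
qed

text \<open>The unsigned estimate is applied to both Jordan parts with the same step values. The
  step sums subtract to the one for \<mu>, and the two errors add up to \<open>e\<close> times the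
  norm because the total masses of the parts add up to the variation.\<close>

lemma signed_integral_step_approx:
  assumes \<mu>: "signed_borel_measure Z \<mu>" and fin: "total_variation Z \<mu> (topspace Z) < \<infinity>"
    and S: "S \<in> sets (borel_on Z)" "total_variation Z \<mu> (topspace Z - S) = 0"
    and P: "finite P" "P \<subseteq> sets (borel_on Z)" "disjoint P" "\<Union>P = S"
    and f: "f \<in> borel_measurable (borel_on Z)"
    and c: "\<And>B x. B \<in> P \<Longrightarrow> x \<in> B \<Longrightarrow> \<bar>f x - c B\<bar> \<le> e"
  shows "\<bar>signed_integral Z \<mu> f - (\<Sum>B\<in>P. c B * \<mu> B)\<bar> \<le> e * enn2real (tv_norm Z \<mu>)"
proof -
  let ?p = "pos_part Z \<mu>" and ?n = "neg_part Z \<mu>" and ?v = "\<lambda>A. enn2real (total_variation Z \<mu> A)"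
  have \<mu>': "signed_borel_measure Z (\<lambda>A. - \<mu> A)" using \<mu> by (rule signed_borel_measure_uminus)
  have fin': "total_variation Z (\<lambda>A. - \<mu> A) (topspace Z) < \<infinity>"
    using fin by (simp add: total_variation_uminus)
  have [simp]: "space ?n = topspace Z" "sets ?n = sets (borel_on Z)"
    by (simp_all add: neg_part_def)
  have p: "measure ?p A = (?v A + \<mu> A) / 2" and n: "measure ?n A = (?v A - \<mu> A) / 2"
    if "A \<in> sets (borel_on Z)" for A
    using measure_pos_part[OF \<mu> fin that] measure_pos_part[OF \<mu>' fin' that]
    by (simp_all add: neg_part_def total_variation_uminus)
  interpret p: finite_measure ?p by (rule finite_measure_pos_part[OF \<mu> fin])
  interpret n: finite_measure ?n
    unfolding neg_part_def by (rule finite_measure_pos_part[OF \<mu>' fin'])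
  have T: "topspace Z - S \<in> sets (borel_on Z)" using S(1) by (intro sets.Diff) simp_all
  \<comment> \<open>A set of variation 0 is null for \<mu>, hence for both Jordan parts.\<close>
  have "\<mu> (topspace Z - S) = 0"
    using abs_le_total_variation[OF fin T] S(2) by simp
  then have 0: "measure ?p (space ?p - S) = 0" "measure ?n (space ?n - S) = 0"
    using S(2) by (simp_all add: p[OF T] n[OF T])
  have fm: "f \<in> borel_measurable ?p" "f \<in> borel_measurable ?n"
    using f by (simp_all cong: measurable_cong_sets)
  have P': "P \<subseteq> sets ?p" "P \<subseteq> sets ?n" "S \<in> sets ?p" "S \<in> sets ?n" using P(2) S(1) by simp_all
  have B: "\<bar>(LINT x|?p. f x) - (\<Sum>B\<in>P. c B * measure ?p B)\<bar> \<le> e * measure ?p (space ?p)"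
    "\<bar>(LINT x|?n. f x) - (\<Sum>B\<in>P. c B * measure ?n B)\<bar> \<le> e * measure ?n (space ?n)"
    by (rule p.integral_step_approx[OF P'(3) 0(1) P(1) P'(1) P(3,4) fm(1) c], assumption+)
       (rule n.integral_step_approx[OF P'(4) 0(2) P(1) P'(2) P(3,4) fm(2) c])
  have "(\<Sum>B\<in>P. c B * measure ?p B) - (\<Sum>B\<in>P. c B * measure ?n B)
      = (\<Sum>B\<in>P. c B * (measure ?p B - measure ?n B))"
    by (simp add: sum_subtractf right_diff_distrib)
  also have "\<dots> = (\<Sum>B\<in>P. c B * \<mu> B)"
    using P(2) by (intro sum.cong refl) (auto simp: p n subset_eq field_simps)
  finally have 1: "(\<Sum>B\<in>P. c B * measure ?p B) - (\<Sum>B\<in>P. c B * measure ?n B) = (\<Sum>B\<in>P. c B * \<mu> B)" .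
  have "measure ?p (space ?p) + measure ?n (space ?n) = ?v (topspace Z)"
    by (simp add: p n field_simps)
  then have 2: "e * measure ?p (space ?p) + e * measure ?n (space ?n) = e * ?v (topspace Z)"
    by (simp flip: distrib_left)
  show ?thesis
    using B 1 2 unfolding signed_integral_def tv_norm_def by linarith
qed

text \<open>Points of \<open>K\<close> are grouped by the vector of the integer parts of
  \<open>f x / e\<close>. Each \<open>f\<close> is bounded on the compact set, so only finitely many
  vectors occur, and equal integer parts force the quotients to differ by at most 1.\<close>

lemma fine_partition:
  assumes H: "Hausdorff_space Z" and K: "compactin Z K" and F: "finite F"
    and cont: "\<And>f. f \<in> F \<Longrightarrow> continuous_map Z euclideanreal f" and e: "e > 0"
  obtains P where "finite P" "P \<subseteq> sets (borel_on Z)" "disjoint P" "\<Union>P = K" "{} \<notin> P"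
    "\<And>B x y f. B \<in> P \<Longrightarrow> x \<in> B \<Longrightarrow> y \<in> B \<Longrightarrow> f \<in> F \<Longrightarrow> \<bar>f x - f y\<bar> \<le> e"
proof -
  \<comment> \<open>The restriction to \<open>F\<close> makes the labels extensional functions, so
    that they lie in a finite \<open>PiE\<close>.\<close>
  define L where "L x = (\<lambda>f\<in>F. \<lfloor>f x / e\<rfloor>)" for x
  \<comment> \<open>Only labels that are attained on \<open>K\<close> are used; hence no cell is
    empty and a point can later be chosen in each.\<close>
  define P where "P = (\<lambda>v. {x \<in> K. L x = v}) ` (L ` K)"
  have KT: "K \<subseteq> topspace Z" using K by (rule compactin_subset_topspace)
  have KB: "K \<in> sets (borel_on Z)" by (rule compactin_borel_on[OF H K])
  have "\<exists>M. \<forall>x\<in>K. \<bar>f x\<bar> \<le> M" if "f \<in> F" for f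
  proof -
    have "compact (f ` K)" using image_compactin[OF K cont[OF that]] by simp
    then have "bounded (f ` K)" by (rule compact_imp_bounded)
    then obtain M where "\<forall>y\<in>f ` K. norm y \<le> M" unfolding bounded_iff ..
    then show ?thesis by (intro exI[of _ M]) simp
  qed
  then obtain M where M: "\<And>f x. f \<in> F \<Longrightarrow> x \<in> K \<Longrightarrow> \<bar>f x\<bar> \<le> M f" by metis
  have "\<lfloor>f x / e\<rfloor> \<in> {\<lfloor>- M f / e\<rfloor>..\<lfloor>M f / e\<rfloor>}" if "f \<in> F" "x \<in> K" for f x
  proof -
    have "- M f \<le> f x" "f x \<le> M f" using M[OF that] by linarith+
    then have "- M f / e \<le> f x / e" "f x / e \<le> M f / e"
      using e by (intro divide_right_mono; simp)+
    then show ?thesis unfolding atLeastAtMost_iff by (intro conjI floor_mono)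
  qed
  then have "L ` K \<subseteq> PiE F (\<lambda>f. {\<lfloor>- M f / e\<rfloor>..\<lfloor>M f / e\<rfloor>})"
    unfolding L_def by (intro image_subsetI restrict_PiE_iff[THEN iffD2] ballI)
  then have "finite (L ` K)" by (rule finite_subset) (intro finite_PiE F finite_atLeastAtMost_int)
  then have finP: "finite P" unfolding P_def by (rule finite_imageI)
  have "{x \<in> K. L x = v} \<in> sets (borel_on Z)" if vL: "v \<in> L ` K" for v
  proof -
    have "{x \<in> K. L x = v} = K \<inter> {x \<in> space (borel_on Z). \<forall>f\<in>F. \<lfloor>f x / e\<rfloor> = v f}"
    proof -
      have "L x = v \<longleftrightarrow> (\<forall>f\<in>F. \<lfloor>f x / e\<rfloor> = v f)" for x
      proof -
        obtain y where v: "v = L y" using vL by blast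
        show ?thesis
        proof
          assume "L x = v"
          then show "\<forall>f\<in>F. \<lfloor>f x / e\<rfloor> = v f" unfolding L_def by auto
        next
          assume "\<forall>f\<in>F. \<lfloor>f x / e\<rfloor> = v f"
          then show "L x = v" unfolding v L_def by (simp add: restrict_def fun_eq_iff)
        qed
      qed
      then show ?thesis using KT unfolding space_borel_on by blast
    qed
    moreover have "{x \<in> space (borel_on Z). \<forall>f\<in>F. \<lfloor>f x / e\<rfloor> = v f} \<in> sets (borel_on Z)"
    proof (intro sets.sets_Collect_finite_All F)
      fix f assume "f \<in> F"
      then have [measurable]: "f \<in> borel_measurable (borel_on Z)"
        by (intro continuous_map_borel_measurable cont)
      show "{x \<in> space (borel_on Z). \<lfloor>f x / e\<rfloor> = v f} \<in> sets (borel_on Z)" by measurable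
    qed
    ultimately show ?thesis using sets.Int[OF KB] by simp
  qed
  then have subP: "P \<subseteq> sets (borel_on Z)" unfolding P_def by blast
  have osc: "\<bar>f x - f y\<bar> \<le> e" if "B \<in> P" "x \<in> B" "y \<in> B" "f \<in> F" for B x y f
  proof -
    have "L x = L y" using that unfolding P_def by auto
    then have "L x f = L y f" by simp
    then have "\<lfloor>f x / e\<rfloor> = \<lfloor>f y / e\<rfloor>" using that(4) unfolding L_def by simp
    then have "\<bar>f x / e - f y / e\<bar> \<le> 1" by linarith
    then have "\<bar>f x - f y\<bar> / e \<le> 1" using e by (simp flip: diff_divide_distrib)
    then show ?thesis using e by (simp add: divide_le_eq)
  qed
  show ?thesis
  proof (rule that[OF finP subP _ _ _ osc])
    show "disjoint P" unfolding P_def pairwise_def disjnt_def by auto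
    show "\<Union>P = K" "{} \<notin> P" unfolding P_def by auto
  qed
qed

subsection \<open>The space of compactly supported measures\<close>

text \<open>The last two facts are not part of \<open>Mc\<close>; regularity supplies them in a
  Hausdorff space.\<close>

lemma McD:
  assumes "\<mu> \<in> Mc Z" "Hausdorff_space Z"
  shows "signed_borel_measure Z \<mu>" "regular_signed_measure Z \<mu>" "compactin Z (msupport Z \<mu>)"
    "total_variation Z \<mu> A < \<infinity>" "total_variation Z \<mu> (topspace Z - msupport Z \<mu>) = 0"
  using assms regular_total_variation_finite[of Z \<mu>] regular_total_variation_outside_support[of Z \<mu>]
  unfolding Mc_def by auto

lemma closedin_msupport: "closedin Z (msupport Z \<mu>)"
  unfolding msupport_def by (intro closedin_diff closedin_topspace openin_Union) simp

lemma compactin_msupport_subset: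
  "compactin Z K \<Longrightarrow> msupport Z \<mu> \<subseteq> K \<Longrightarrow> compactin Z (msupport Z \<mu>)"
  by (erule (1) closed_compactin) (rule closedin_msupport)

lemma msupport_iff:
  "x \<in> msupport Z \<mu> \<longleftrightarrow> x \<in> topspace Z \<and> (\<forall>U. openin Z U \<and> x \<in> U \<longrightarrow> total_variation Z \<mu> U \<noteq> 0)"
  by (auto simp: msupport_def)

text \<open>A point outside both supports has an open null neighbourhood for either measure; their
  intersection is null for the sum.\<close>

lemma msupport_add: "msupport Z (\<lambda>A. \<mu> A + \<nu> A) \<subseteq> msupport Z \<mu> \<union> msupport Z \<nu>"
proof
  fix x assume x: "x \<in> msupport Z (\<lambda>A. \<mu> A + \<nu> A)"
  show "x \<in> msupport Z \<mu> \<union> msupport Z \<nu>"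
  proof (rule ccontr)
    assume "x \<notin> msupport Z \<mu> \<union> msupport Z \<nu>"
    moreover have "x \<in> topspace Z" using x by (simp add: msupport_iff)
    ultimately obtain U V where U: "openin Z U" "x \<in> U" "total_variation Z \<mu> U = 0"
      and V: "openin Z V" "x \<in> V" "total_variation Z \<nu> V = 0"
      by (auto simp: msupport_iff)
    have "total_variation Z (\<lambda>A. \<mu> A + \<nu> A) (U \<inter> V)
        \<le> total_variation Z \<mu> (U \<inter> V) + total_variation Z \<nu> (U \<inter> V)"
      by (rule total_variation_add_le)
    also have "\<dots> \<le> total_variation Z \<mu> U + total_variation Z \<nu> V"
      using openin_borel_on[OF U(1)] openin_borel_on[OF V(1)]
      by (intro add_mono total_variation_mono) simp_all
    finally have "total_variation Z (\<lambda>A. \<mu> A + \<nu> A) (U \<inter> V) = 0" using U V by simp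
    then show False using x U(2) V(2) openin_Int[OF U(1) V(1)] by (auto simp: msupport_iff)
  qed
qed

lemma msupport_scale: "msupport Z (\<lambda>A. c * \<mu> A) \<subseteq> msupport Z \<mu>"
proof
  fix x assume x: "x \<in> msupport Z (\<lambda>A. c * \<mu> A)"
  have "total_variation Z (\<lambda>A. c * \<mu> A) U = 0" if "total_variation Z \<mu> U = 0" for U
    using total_variation_scale_le[of Z c \<mu> U] that by simp
  with x show "x \<in> msupport Z \<mu>" by (auto simp: msupport_iff)
qed

section \<open>Closure of the space under sums and multiples\<close>

lemma regular_signed_measureI:
  assumes "\<And>A e. A \<in> sets (borel_on Z) \<Longrightarrow> 0 < e \<Longrightarrow>
    \<exists>K U. compactin Z K \<and> openin Z U \<and> K \<subseteq> A \<and> A \<subseteq> U \<and> total_variation Z \<mu> (U - K) < ennreal e"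
  shows "regular_signed_measure Z \<mu>"
  unfolding regular_signed_measure_def
proof (intro ballI allI impI)
  fix A and \<epsilon> :: ennreal assume A: "A \<in> sets (borel_on Z)" and "\<epsilon> > 0"
  then obtain e where e: "e > 0" "ennreal e \<le> \<epsilon>"
    \<comment> \<open>For infinite \<epsilon> any positive real will do, here 1.\<close>
    by (cases \<epsilon>) (auto intro: that[of 1])
  from assms[OF A e(1)] show
    "\<exists>K U. compactin Z K \<and> openin Z U \<and> K \<subseteq> A \<and> A \<subseteq> U \<and> total_variation Z \<mu> (U - K) < \<epsilon>"
    using e(2) by (meson order_less_le_trans)
qed

text \<open>The union of the inner sets and the intersection of the outer sets work for the sum,
  because what lies between them is contained in both \<open>U - K\<close> and
  \<open>V - L\<close>.\<close>

lemma regular_signed_measure_add: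
  assumes H: "Hausdorff_space Z" and \<mu>: "regular_signed_measure Z \<mu>" and \<nu>: "regular_signed_measure Z \<nu>"
  shows "regular_signed_measure Z (\<lambda>A. \<mu> A + \<nu> A)"
proof (rule regular_signed_measureI)
  fix A and e :: real assume A: "A \<in> sets (borel_on Z)" and e: "0 < e"
  then have e2: "0 < ennreal (e / 2)" by simp
  obtain K U where KU: "compactin Z K" "openin Z U" "K \<subseteq> A" "A \<subseteq> U" "total_variation Z \<mu> (U - K) < ennreal (e / 2)"
    by (rule regular_signed_measureE[OF \<mu> A e2])
  obtain L V where LV: "compactin Z L" "openin Z V" "L \<subseteq> A" "A \<subseteq> V" "total_variation Z \<nu> (V - L) < ennreal (e / 2)"
    by (rule regular_signed_measureE[OF \<nu> A e2])
  have b: "U - K \<in> sets (borel_on Z)" "V - L \<in> sets (borel_on Z)"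
    using openin_borel_on[OF KU(2)] openin_borel_on[OF LV(2)] compactin_borel_on[OF H KU(1)]
      compactin_borel_on[OF H LV(1)] by (simp_all add: sets.Diff)
  let ?D = "U \<inter> V - (K \<union> L)"
  have "total_variation Z (\<lambda>A. \<mu> A + \<nu> A) ?D \<le> total_variation Z \<mu> ?D + total_variation Z \<nu> ?D"
    by (rule total_variation_add_le)
  also have "\<dots> \<le> total_variation Z \<mu> (U - K) + total_variation Z \<nu> (V - L)"
    by (intro add_mono total_variation_mono b) blast+
  also have "\<dots> < ennreal (e / 2) + ennreal (e / 2)"
    using KU(5) LV(5) by (rule add_strict_mono)
  also have "\<dots> = ennreal e" using e by (simp flip: ennreal_plus)
  finally have "total_variation Z (\<lambda>A. \<mu> A + \<nu> A) ?D < ennreal e" .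
  moreover have "compactin Z (K \<union> L)" "openin Z (U \<inter> V)" "K \<union> L \<subseteq> A" "A \<subseteq> U \<inter> V"
    using KU LV by (simp_all add: compactin_Un openin_Int)
  ultimately show "\<exists>K U. compactin Z K \<and> openin Z U \<and> K \<subseteq> A \<and> A \<subseteq> U \<and>
      total_variation Z (\<lambda>A. \<mu> A + \<nu> A) (U - K) < ennreal e" by blast
qed

lemma regular_signed_measure_scale:
  assumes \<mu>: "regular_signed_measure Z \<mu>"
  shows "regular_signed_measure Z (\<lambda>A. c * \<mu> A)"
proof (rule regular_signed_measureI)
  fix A and e :: real assume A: "A \<in> sets (borel_on Z)" and e: "0 < e"
  \<comment> \<open>The summand 1 keeps the denominator positive when \<open>c\<close> is 0 and
    makes the final estimate strict.\<close>
  then have e2: "0 < ennreal (e / (\<bar>c\<bar> + 1))" by simp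
  obtain K U where KU: "compactin Z K" "openin Z U" "K \<subseteq> A" "A \<subseteq> U"
      "total_variation Z \<mu> (U - K) < ennreal (e / (\<bar>c\<bar> + 1))"
    by (rule regular_signed_measureE[OF \<mu> A e2])
  have "total_variation Z (\<lambda>A. c * \<mu> A) (U - K) \<le> ennreal \<bar>c\<bar> * total_variation Z \<mu> (U - K)"
    by (rule total_variation_scale_le)
  also have "\<dots> \<le> ennreal \<bar>c\<bar> * ennreal (e / (\<bar>c\<bar> + 1))"
    using KU(5) by (intro mult_left_mono) simp_all
  also have "\<dots> = ennreal (\<bar>c\<bar> * (e / (\<bar>c\<bar> + 1)))" using e by (intro ennreal_mult[symmetric]) simp_all
  also have "\<dots> < ennreal e"
    using e by (intro ennreal_lessI) (simp_all add: divide_less_eq)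
  finally show "\<exists>K U. compactin Z K \<and> openin Z U \<and> K \<subseteq> A \<and> A \<subseteq> U \<and>
      total_variation Z (\<lambda>A. c * \<mu> A) (U - K) < ennreal e" using KU by blast
qed

lemma Mc_add:
  assumes "\<mu> \<in> Mc Z" "\<nu> \<in> Mc Z" "Hausdorff_space Z"
  shows "(\<lambda>A. \<mu> A + \<nu> A) \<in> Mc Z"
  using McD[OF assms(1,3)] McD[OF assms(2,3)] msupport_add[of Z \<mu> \<nu>]
  by (simp add: Mc_def signed_borel_measure_add regular_signed_measure_add assms(3)
      compactin_msupport_subset[OF compactin_Un])

lemma Mc_scale:
  assumes "\<mu> \<in> Mc Z" "Hausdorff_space Z"
  shows "(\<lambda>A. c * \<mu> A) \<in> Mc Z"
  using McD[OF assms] msupport_scale[of Z c \<mu>]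
  by (simp add: Mc_def signed_borel_measure_scale regular_signed_measure_scale
      compactin_msupport_subset)

text \<open>The variation vanishes off the support, hence off any compact \<open>K\<close>
  containing it, so a partition of \<open>K\<close> alone suffices.\<close>

lemma Mc_signed_integral_approx:
  assumes "\<mu> \<in> Mc Z" "Hausdorff_space Z" "compactin Z K" "msupport Z \<mu> \<subseteq> K"
    "finite P" "P \<subseteq> sets (borel_on Z)" "disjoint P" "\<Union>P = K" "continuous_map Z euclideanreal f"
    "\<And>B x. B \<in> P \<Longrightarrow> x \<in> B \<Longrightarrow> \<bar>f x - c B\<bar> \<le> e"
  shows "\<bar>signed_integral Z \<mu> f - (\<Sum>B\<in>P. c B * \<mu> B)\<bar> \<le> e * enn2real (tv_norm Z \<mu>)"
proof (rule signed_integral_step_approx)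
  have "msupport Z \<mu> \<in> sets (borel_on Z)"
    using McD(3)[OF assms(1,2)] by (rule compactin_borel_on[OF assms(2)])
  then have "total_variation Z \<mu> (topspace Z - K) \<le> total_variation Z \<mu> (topspace Z - msupport Z \<mu>)"
    using assms(4) by (intro total_variation_mono sets.Diff) auto
  then show "total_variation Z \<mu> (topspace Z - K) = 0" by (simp add: McD(5)[OF assms(1,2)])
  show "f \<in> borel_measurable (borel_on Z)" using assms(9) by (rule continuous_map_borel_measurable)
qed (use assms McD[OF assms(1,2)] compactin_borel_on in simp_all)

text \<open>One partition serves all measures on \<open>K\<close>, and all functions agreeing with \<open>f\<close> on \<open>K\<close>. This
  reduces the linearity of the integral in the measure to finite sums.\<close>

lemma Mc_uniform_approx:
  assumes H: "Hausdorff_space Z" and K: "compactin Z K"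
    and f: "continuous_map Z euclideanreal f" and e: "e > 0"
  obtains P c where "finite P"
    "\<And>\<mu> g. \<mu> \<in> Mc Z \<Longrightarrow> msupport Z \<mu> \<subseteq> K \<Longrightarrow> continuous_map Z euclideanreal g \<Longrightarrow>
       (\<And>x. x \<in> K \<Longrightarrow> g x = f x) \<Longrightarrow>
       \<bar>signed_integral Z \<mu> g - (\<Sum>B\<in>P. c B * \<mu> B)\<bar> \<le> e * enn2real (tv_norm Z \<mu>)"
proof -
  have cf: "continuous_map Z euclideanreal h" if "h \<in> {f}" for h using f that by simp
  have "finite {f}" by simp
  from H K this cf e obtain P where P: "finite P" "P \<subseteq> sets (borel_on Z)" "disjoint P" "\<Union>P = K" "{} \<notin> P"
    "\<And>B x y h. B \<in> P \<Longrightarrow> x \<in> B \<Longrightarrow> y \<in> B \<Longrightarrow> h \<in> {f} \<Longrightarrow> \<bar>h x - h y\<bar> \<le> e"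
    by (rule fine_partition) (assumption, rule that)
  define c where "c B = f (SOME x. x \<in> B)" for B
  show ?thesis
  proof (rule that[of P c, OF P(1)])
    fix \<mu> g
    assume \<mu>: "\<mu> \<in> Mc Z" "msupport Z \<mu> \<subseteq> K" and g: "continuous_map Z euclideanreal g"
      and gf: "\<And>x. x \<in> K \<Longrightarrow> g x = f x"
    show "\<bar>signed_integral Z \<mu> g - (\<Sum>B\<in>P. c B * \<mu> B)\<bar> \<le> e * enn2real (tv_norm Z \<mu>)"
    proof (rule Mc_signed_integral_approx[OF \<mu>(1) H K \<mu>(2) P(1-4) g])
      fix B x assume B: "B \<in> P" "x \<in> B"
      then have "x \<in> K" using P(4) by blast
      moreover have "\<bar>f x - c B\<bar> \<le> e"
        unfolding c_def using B(2) by (intro P(6)[OF B]) (auto intro: someI)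
      ultimately show "\<bar>g x - c B\<bar> \<le> e" using gf by simp
    qed
  qed
qed

section \<open>Dependence on the support and linearity of the integral\<close>

lemma abs_le_mult_imp_zero:
  fixes x C :: real
  assumes "C \<ge> 0" "\<And>e. e > 0 \<Longrightarrow> \<bar>x\<bar> \<le> e * C"
  shows "x = 0"
proof (rule ccontr)
  assume "x \<noteq> 0"
  \<comment> \<open>With this value of \<open>e\<close> the bound becomes |x| (C + 1) \<le> |x| C;
    the summand 1 also covers \<open>C = 0\<close>.\<close>
  then have "\<bar>x\<bar> / (C + 1) > 0" using assms(1) by simp
  from assms(2)[OF this] have "\<bar>x\<bar> * (C + 1) \<le> \<bar>x\<bar> * C"
    using assms(1) by (simp add: field_simps)
  with \<open>x \<noteq> 0\<close> show False by (simp add: distrib_left)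
qed

text \<open>Both integrals are within \<open>e\<close> times the norm of one and the same step sum.
  Later this makes the integral independent of the chosen extension of a function from the
  support.\<close>

lemma signed_integral_cong_support:
  assumes \<mu>: "\<mu> \<in> Mc Z" and H: "Hausdorff_space Z"
    and f: "continuous_map Z euclideanreal f" and g: "continuous_map Z euclideanreal g"
    and fg: "\<And>x. x \<in> msupport Z \<mu> \<Longrightarrow> g x = f x"
  shows "signed_integral Z \<mu> g = signed_integral Z \<mu> f"
proof -
  have "signed_integral Z \<mu> g - signed_integral Z \<mu> f = 0"
  proof (rule abs_le_mult_imp_zero[of "2 * enn2real (tv_norm Z \<mu>)"])
    fix e :: real assume "e > 0"
    from H McD(3)[OF \<mu> H] f this obtain P c where
      a: "\<And>\<nu> g. \<nu> \<in> Mc Z \<Longrightarrow> msupport Z \<nu> \<subseteq> msupport Z \<mu> \<Longrightarrow> continuous_map Z euclideanreal g \<Longrightarrow>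
       (\<And>x. x \<in> msupport Z \<mu> \<Longrightarrow> g x = f x) \<Longrightarrow>
       \<bar>signed_integral Z \<nu> g - (\<Sum>B\<in>P. c B * \<nu> B)\<bar> \<le> e * enn2real (tv_norm Z \<nu>)"
      by (rule Mc_uniform_approx) blast
    show "\<bar>signed_integral Z \<mu> g - signed_integral Z \<mu> f\<bar> \<le> e * (2 * enn2real (tv_norm Z \<mu>))"
      using a[OF \<mu> order_refl g fg] a[OF \<mu> order_refl f refl] by linarith
  qed simp
  then show ?thesis by simp
qed

text \<open>The Jordan parts of a sum are in general not the sums of the Jordan parts, so additivity
  is not read off the definition. Instead one family of step sums on the union of the supports
  approximates all three integrals, and these sums are additive in the measure.\<close>

lemma signed_integral_add:
  assumes \<mu>: "\<mu> \<in> Mc Z" and \<nu>: "\<nu> \<in> Mc Z" and H: "Hausdorff_space Z"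
    and f: "continuous_map Z euclideanreal f"
  shows "signed_integral Z (\<lambda>A. \<mu> A + \<nu> A) f = signed_integral Z \<mu> f + signed_integral Z \<nu> f"
proof -
  let ?s = "\<lambda>A. \<mu> A + \<nu> A" and ?K = "msupport Z \<mu> \<union> msupport Z \<nu>"
  let ?r = "\<lambda>\<mu>. enn2real (tv_norm Z \<mu>)"
  have "signed_integral Z ?s f - (signed_integral Z \<mu> f + signed_integral Z \<nu> f) = 0"
  proof (rule abs_le_mult_imp_zero[of "?r ?s + ?r \<mu> + ?r \<nu>"])
    fix e :: real assume "e > 0"
    from H compactin_Un[OF McD(3)[OF \<mu> H] McD(3)[OF \<nu> H]] f this obtain P c where
      a: "\<And>\<rho> g. \<rho> \<in> Mc Z \<Longrightarrow> msupport Z \<rho> \<subseteq> ?K \<Longrightarrow> continuous_map Z euclideanreal g \<Longrightarrow>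
       (\<And>x. x \<in> ?K \<Longrightarrow> g x = f x) \<Longrightarrow>
       \<bar>signed_integral Z \<rho> g - (\<Sum>B\<in>P. c B * \<rho> B)\<bar> \<le> e * ?r \<rho>"
      by (rule Mc_uniform_approx) blast
    have "(\<Sum>B\<in>P. c B * ?s B) = (\<Sum>B\<in>P. c B * \<mu> B) + (\<Sum>B\<in>P. c B * \<nu> B)"
      by (simp add: distrib_left sum.distrib)
    then show "\<bar>signed_integral Z ?s f - (signed_integral Z \<mu> f + signed_integral Z \<nu> f)\<bar>
        \<le> e * (?r ?s + ?r \<mu> + ?r \<nu>)"
      using a[OF Mc_add[OF \<mu> \<nu> H] msupport_add f refl] a[OF \<mu> Un_upper1 f refl]
        a[OF \<nu> Un_upper2 f refl] unfolding distrib_left by linarith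
  qed simp
  then show ?thesis by simp
qed

lemma signed_integral_scale:
  assumes \<mu>: "\<mu> \<in> Mc Z" and H: "Hausdorff_space Z" and f: "continuous_map Z euclideanreal f"
  shows "signed_integral Z (\<lambda>A. a * \<mu> A) f = a * signed_integral Z \<mu> f"
proof -
  let ?s = "\<lambda>A. a * \<mu> A" and ?K = "msupport Z \<mu>"
  let ?r = "\<lambda>\<mu>. enn2real (tv_norm Z \<mu>)"
  have "signed_integral Z ?s f - a * signed_integral Z \<mu> f = 0"
  proof (rule abs_le_mult_imp_zero[of "?r ?s + \<bar>a\<bar> * ?r \<mu>"])
    fix e :: real assume "e > 0"
    from H McD(3)[OF \<mu> H] f this obtain P c where
      A: "\<And>\<rho> g. \<rho> \<in> Mc Z \<Longrightarrow> msupport Z \<rho> \<subseteq> ?K \<Longrightarrow> continuous_map Z euclideanreal g \<Longrightarrow>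
       (\<And>x. x \<in> ?K \<Longrightarrow> g x = f x) \<Longrightarrow>
       \<bar>signed_integral Z \<rho> g - (\<Sum>B\<in>P. c B * \<rho> B)\<bar> \<le> e * ?r \<rho>"
      by (rule Mc_uniform_approx) blast
    let ?m = "\<Sum>B\<in>P. c B * \<mu> B"
    have "(\<Sum>B\<in>P. c B * ?s B) = a * ?m"
      by (simp add: sum_distrib_left mult.left_commute)
    then have "\<bar>signed_integral Z ?s f - a * ?m\<bar> \<le> e * ?r ?s"
      using A[OF Mc_scale[OF \<mu> H] msupport_scale f refl, of a] by simp
    moreover have "\<bar>a * signed_integral Z \<mu> f - a * ?m\<bar> \<le> \<bar>a\<bar> * (e * ?r \<mu>)"
      using mult_left_mono[OF A[OF \<mu> order_refl f refl], of "\<bar>a\<bar>"]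
      by (simp flip: abs_mult right_diff_distrib)
    moreover have "e * (?r ?s + \<bar>a\<bar> * ?r \<mu>) = e * ?r ?s + \<bar>a\<bar> * (e * ?r \<mu>)"
      by (simp add: algebra_simps)
    ultimately show "\<bar>signed_integral Z ?s f - a * signed_integral Z \<mu> f\<bar> \<le> e * (?r ?s + \<bar>a\<bar> * ?r \<mu>)"
      by linarith
  qed simp
  then show ?thesis by simp
qed

lemma linear_form_signed_integral:
  assumes "Hausdorff_space Z" "continuous_map Z euclideanreal f"
  shows "linear_form Z (\<lambda>\<mu>. signed_integral Z \<mu> f)"
  unfolding linear_form_def using assms by (simp add: signed_integral_add signed_integral_scale)

section \<open>Point masses\<close>

definition dirac :: "'a topology \<Rightarrow> 'a \<Rightarrow> 'a set \<Rightarrow> real" where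
  "dirac Z x A = (if A \<in> sets (borel_on Z) then indicator A x else 0)"

lemma total_variation_dirac_notin:
  assumes "x \<notin> A" shows "total_variation Z (dirac Z x) A = 0"
proof -
  have "total_variation Z (dirac Z x) A \<le> 0"
  proof (rule total_variation_least)
    fix P assume "\<Union>P = A"
    then have "dirac Z x B = 0" if "B \<in> P" for B using assms that by (auto simp: dirac_def)
    then show "(\<Sum>B\<in>P. ennreal \<bar>dirac Z x B\<bar>) \<le> 0" by simp
  qed
  then show ?thesis by simp
qed

text \<open>At most one of the disjoint pieces contains \<open>x\<close>.\<close>

lemma tv_norm_dirac_le: "tv_norm Z (dirac Z x) \<le> 1"
  unfolding tv_norm_def
proof (rule total_variation_least)
  fix P assume P: "finite P" "P \<subseteq> sets (borel_on Z)" "disjoint P"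
  show "(\<Sum>B\<in>P. ennreal \<bar>dirac Z x B\<bar>) \<le> 1"
  proof (cases "\<exists>B\<in>P. x \<in> B")
    case True
    then obtain B where B: "B \<in> P" "x \<in> B" by blast
    have "dirac Z x C = 0" if "C \<in> P - {B}" for C
    proof -
      have "x \<notin> C" using that B P(3) unfolding pairwise_def disjnt_def by blast
      then show ?thesis by (simp add: dirac_def)
    qed
    then have "(\<Sum>B\<in>P. ennreal \<bar>dirac Z x B\<bar>) = (\<Sum>B\<in>{B}. ennreal \<bar>dirac Z x B\<bar>)"
      using P(1) B(1) by (intro sum.mono_neutral_right) auto
    also have "\<dots> \<le> 1" by (simp add: dirac_def indicator_def)
    finally show ?thesis .
  next
    case False
    then have "\<forall>B\<in>P. ennreal \<bar>dirac Z x B\<bar> = 0" by (simp add: dirac_def)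
    then show ?thesis by simp
  qed
qed

lemma dirac_Mc:
  assumes H: "Hausdorff_space Z" and x: "x \<in> topspace Z"
  shows "dirac Z x \<in> Mc Z" "msupport Z (dirac Z x) \<subseteq> {x}"
proof -
  have cx: "compactin Z {x}" using x by simp
  then have ox: "openin Z (topspace Z - {x})"
    by (intro openin_diff openin_topspace compactin_imp_closedin[OF H])
  have "total_variation Z (dirac Z x) (topspace Z - {x}) = 0"
    by (rule total_variation_dirac_notin) simp
  then show supp: "msupport Z (dirac Z x) \<subseteq> {x}"
    using ox by (auto simp: msupport_iff)
  have "signed_borel_measure Z (dirac Z x)"
  proof (rule signed_borel_measureI)
    fix A :: "nat \<Rightarrow> 'a set" assume A: "range A \<subseteq> sets (borel_on Z)" "disjoint_family A"
    have "(\<lambda>i. indicator (A i) x :: real) sums indicator (\<Union>i. A i) x"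
      using disjoint_family_onD[OF A(2)] by (intro indicator_sums) simp
    moreover have "(\<Union>i. A i) \<in> sets (borel_on Z)" using A(1) by (intro sets.countable_UN)
    moreover have "A i \<in> sets (borel_on Z)" for i using A(1) by blast
    ultimately show "(\<lambda>i. dirac Z x (A i)) sums dirac Z x (\<Union>i. A i)" by (simp add: dirac_def)
  qed (simp_all add: dirac_def)
  moreover have "regular_signed_measure Z (dirac Z x)"
  proof (rule regular_signed_measureI)
    fix A and e :: real assume A: "A \<in> sets (borel_on Z)" and e: "e > 0"
    show "\<exists>K U. compactin Z K \<and> openin Z U \<and> K \<subseteq> A \<and> A \<subseteq> U \<and>
        total_variation Z (dirac Z x) (U - K) < ennreal e"
    \<comment> \<open>The inner and outer sets are \<open>{x}\<close> and the whole space if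
      \<open>x\<close> lies in \<open>A\<close>, otherwise the empty set and the complement of
      \<open>{x}\<close>. In both cases their difference misses \<open>x\<close> and has variation
      0.\<close>
    proof (cases "x \<in> A")
      case True
      have "total_variation Z (dirac Z x) (topspace Z - {x}) < ennreal e"
        using e by (simp add: total_variation_dirac_notin)
      then show ?thesis
        using True sets.sets_into_space[OF A] cx by (intro exI[of _ "{x}"] exI[of _ "topspace Z"]) simp
    next
      case False
      have "total_variation Z (dirac Z x) (topspace Z - {x} - {}) < ennreal e"
        using e by (simp add: total_variation_dirac_notin)
      moreover have "A \<subseteq> topspace Z - {x}" using False sets.sets_into_space[OF A] by auto
      ultimately show ?thesis
        using ox by (intro exI[of _ "{}"] exI[of _ "topspace Z - {x}"]) simp
    qed
  qed
  ultimately show "dirac Z x \<in> Mc Z"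
    using supp compactin_msupport_subset[OF cx] by (simp add: Mc_def)
qed

lemma signed_integral_dirac:
  assumes H: "Hausdorff_space Z" and x: "x \<in> topspace Z" and f: "continuous_map Z euclideanreal f"
  shows "signed_integral Z (dirac Z x) f = f x"
proof -
  have c: "compactin Z {x}" using x by simp
  have b: "{x} \<in> sets (borel_on Z)" by (rule compactin_borel_on[OF H c])
  \<comment> \<open>On the one-cell partition of \<open>{x}\<close> the function is constant, so the
    step approximation has error 0.\<close>
  have "\<bar>signed_integral Z (dirac Z x) f - (\<Sum>B\<in>{{x}}. f x * dirac Z x B)\<bar>
      \<le> 0 * enn2real (tv_norm Z (dirac Z x))"
    by (rule Mc_signed_integral_approx[OF dirac_Mc(1)[OF H x] H c dirac_Mc(2)[OF H x] _ _ _ _ f])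
       (use b in auto)
  then show ?thesis using b by (simp add: dirac_def)
qed

lemma zero_Mc: "(\<lambda>A. 0) \<in> Mc Z" "msupport Z (\<lambda>A. 0) = {}"
proof -
  have tv: "total_variation Z (\<lambda>A. 0) A = 0" for A
    using total_variation_scale_le[of Z 0 "\<lambda>A. 0" A] by simp
  then show supp: "msupport Z (\<lambda>A. 0) = {}"
    by (auto simp: msupport_iff)
  have "\<exists>K U. compactin Z K \<and> openin Z U \<and> K \<subseteq> A \<and> A \<subseteq> U"
    if "A \<in> sets (borel_on Z)" for A
    using sets.sets_into_space[OF that] by (intro exI[of _ "{}"] exI[of _ "topspace Z"]) simp
  then have "regular_signed_measure Z (\<lambda>A. 0)"
    by (intro regular_signed_measureI) (simp add: tv)
  moreover have "signed_borel_measure Z (\<lambda>A. 0)" by (rule signed_borel_measureI) simp_all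
  ultimately show "(\<lambda>A. 0) \<in> Mc Z" by (simp add: Mc_def supp)
qed

section \<open>Linear forms on finite combinations of point masses\<close>

lemma linear_formD:
  assumes "linear_form Z \<phi>"
  shows "\<mu> \<in> Mc Z \<Longrightarrow> \<nu> \<in> Mc Z \<Longrightarrow> \<phi> (\<lambda>A. \<mu> A + \<nu> A) = \<phi> \<mu> + \<phi> \<nu>"
    "\<mu> \<in> Mc Z \<Longrightarrow> \<phi> (\<lambda>A. c * \<mu> A) = c * \<phi> \<mu>"
  using assms by (simp_all add: linear_form_def)

lemma linear_form_zero: "linear_form Z \<phi> \<Longrightarrow> \<phi> (\<lambda>A. 0) = 0"
  using linear_formD(2)[OF _ zero_Mc(1), of Z \<phi> 0] by simp

text \<open>The claims share one induction: \<phi> is additive only on \<open>Mc Z\<close>, so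
  evaluating it at the next partial sum requires that the previous one belongs to the space.\<close>

lemma dirac_combination:
  fixes c :: "'b \<Rightarrow> real"
  assumes H: "Hausdorff_space Z" and K: "compactin Z K" and "finite P"
    and x: "\<And>B. B \<in> P \<Longrightarrow> x B \<in> K"
  defines "\<nu> \<equiv> \<lambda>A. \<Sum>B\<in>P. c B * dirac Z (x B) A"
  shows "\<nu> \<in> Mc Z" "msupport Z \<nu> \<subseteq> K" "tv_norm Z \<nu> \<le> (\<Sum>B\<in>P. ennreal \<bar>c B\<bar>)"
    "linear_form Z \<phi> \<Longrightarrow> \<phi> \<nu> = (\<Sum>B\<in>P. c B * \<phi> (dirac Z (x B)))"
proof -
  have "(\<lambda>A. \<Sum>B\<in>P. c B * dirac Z (x B) A) \<in> Mc Z
    \<and> msupport Z (\<lambda>A. \<Sum>B\<in>P. c B * dirac Z (x B) A) \<subseteq> K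
    \<and> tv_norm Z (\<lambda>A. \<Sum>B\<in>P. c B * dirac Z (x B) A) \<le> (\<Sum>B\<in>P. ennreal \<bar>c B\<bar>)
    \<and> (linear_form Z \<phi> \<longrightarrow>
        \<phi> (\<lambda>A. \<Sum>B\<in>P. c B * dirac Z (x B) A) = (\<Sum>B\<in>P. c B * \<phi> (dirac Z (x B))))"
    using \<open>finite P\<close> x
  proof (induction P)
    case empty
    have "tv_norm Z (\<lambda>A. 0) = 0"
      using total_variation_scale_le[of Z 0 "\<lambda>A. 0" "topspace Z"] by (simp add: tv_norm_def)
    then show ?case using zero_Mc[of Z] linear_form_zero[of Z \<phi>] by simp
  next
    case (insert B P)
    let ?\<nu> = "\<lambda>A. \<Sum>B\<in>P. c B * dirac Z (x B) A" and ?d = "\<lambda>A. c B * dirac Z (x B) A"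
    have IH: "?\<nu> \<in> Mc Z" "msupport Z ?\<nu> \<subseteq> K" "tv_norm Z ?\<nu> \<le> (\<Sum>B\<in>P. ennreal \<bar>c B\<bar>)"
      "linear_form Z \<phi> \<Longrightarrow> \<phi> ?\<nu> = (\<Sum>B\<in>P. c B * \<phi> (dirac Z (x B)))"
      using insert.IH insert.prems by simp_all
    have xB: "x B \<in> K" "x B \<in> topspace Z"
      using insert.prems compactin_subset_topspace[OF K] by auto
    note dM = dirac_Mc(1)[OF H xB(2)]
    note d = Mc_scale[OF dM H, of "c B"]
    have eq: "(\<lambda>A. \<Sum>B\<in>insert B P. c B * dirac Z (x B) A) = (\<lambda>A. ?d A + ?\<nu> A)"
      using insert.hyps by simp
    have "msupport Z (\<lambda>A. ?d A + ?\<nu> A) \<subseteq> K"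
      using msupport_add[of Z ?d ?\<nu>] msupport_scale[of Z "c B" "dirac Z (x B)"]
        dirac_Mc(2)[OF H xB(2)] xB(1) IH(2) by blast
    moreover have "tv_norm Z (\<lambda>A. ?d A + ?\<nu> A) \<le> (\<Sum>B\<in>insert B P. ennreal \<bar>c B\<bar>)"
    proof -
      have "tv_norm Z (\<lambda>A. ?d A + ?\<nu> A) \<le> tv_norm Z ?d + tv_norm Z ?\<nu>"
        unfolding tv_norm_def by (rule total_variation_add_le)
      also have "\<dots> \<le> ennreal \<bar>c B\<bar> + (\<Sum>B\<in>P. ennreal \<bar>c B\<bar>)"
      proof (rule add_mono[OF _ IH(3)])
        have "tv_norm Z ?d \<le> ennreal \<bar>c B\<bar> * tv_norm Z (dirac Z (x B))"
          unfolding tv_norm_def by (rule total_variation_scale_le)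
        also have "\<dots> \<le> ennreal \<bar>c B\<bar> * 1" by (intro mult_left_mono tv_norm_dirac_le) simp
        finally show "tv_norm Z ?d \<le> ennreal \<bar>c B\<bar>" by simp
      qed
      finally show ?thesis using insert.hyps by simp
    qed
    moreover have "\<phi> (\<lambda>A. ?d A + ?\<nu> A) = (\<Sum>B\<in>insert B P. c B * \<phi> (dirac Z (x B)))"
      if \<phi>: "linear_form Z \<phi>"
    proof -
      have "\<phi> (\<lambda>A. ?d A + ?\<nu> A) = \<phi> ?d + \<phi> ?\<nu>"
        by (rule linear_formD(1)[OF \<phi> d IH(1)])
      moreover have "\<phi> ?d = c B * \<phi> (dirac Z (x B))"
        by (rule linear_formD(2)[OF \<phi> dM])
      ultimately show ?thesis using IH(4)[OF \<phi>] insert.hyps by simp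
    qed
    ultimately show ?case unfolding eq using Mc_add[OF d IH(1) H] by (intro conjI impI)
  qed
  then show "\<nu> \<in> Mc Z" "msupport Z \<nu> \<subseteq> K" "tv_norm Z \<nu> \<le> (\<Sum>B\<in>P. ennreal \<bar>c B\<bar>)"
    "linear_form Z \<phi> \<Longrightarrow> \<phi> \<nu> = (\<Sum>B\<in>P. c B * \<phi> (dirac Z (x B)))"
    unfolding \<nu>_def by simp_all
qed

subsection \<open>The weak-star topology\<close>

lemma topspace_weak_star [simp]: "topspace (weak_star Z) = Mc Z"
  unfolding weak_star_def topspace_pullback_topology by auto

lemma continuous_map_signed_integral:
  assumes "continuous_map Z euclideanreal f"
  shows "continuous_map (weak_star Z) euclideanreal (\<lambda>\<mu>. signed_integral Z \<mu> f)"
proof -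
  let ?C = "{f. continuous_map Z euclideanreal f}"
  have "continuous_map (product_topology (\<lambda>_. euclideanreal) ?C) euclideanreal (\<lambda>g. g f)"
    using assms by (intro continuous_map_product_projection) simp
  from continuous_map_pullback[OF this, of "Mc Z" "\<lambda>\<mu>. \<lambda>f\<in>?C. signed_integral Z \<mu> f"] show ?thesis
    unfolding weak_star_def comp_def using assms by simp
qed

text \<open>For an initial topology it suffices to check the coordinates, and the coordinate at
  \<open>f\<close> is \<open>f\<close> itself.\<close>

lemma continuous_map_dirac:
  assumes H: "Hausdorff_space Z"
  shows "continuous_map Z (weak_star Z) (dirac Z)"
  unfolding weak_star_def
proof (rule continuous_map_pullback')
  show "topspace Z \<subseteq> dirac Z -` Mc Z" using dirac_Mc(1)[OF H] by blast
  let ?C = "{f. continuous_map Z euclideanreal f}"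
  show "continuous_map Z (product_topology (\<lambda>_. euclideanreal) ?C)
      ((\<lambda>\<mu>. \<lambda>f\<in>?C. signed_integral Z \<mu> f) \<circ> dirac Z)"
    unfolding continuous_map_componentwise
  proof (intro conjI ballI)
    fix f assume "f \<in> ?C"
    then show "continuous_map Z euclideanreal
        (\<lambda>x. ((\<lambda>\<mu>. \<lambda>f\<in>?C. signed_integral Z \<mu> f) \<circ> dirac Z) x f)"
      by (auto intro: continuous_map_eq[of _ _ f] simp: signed_integral_dirac[OF H])
  qed auto
qed

text \<open>A basic open box constrains only finitely many coordinates, so one \<open>e\<close>
  below the radii of all of them describes a neighbourhood contained in \<open>T\<close>.\<close>

lemma weak_star_neighbourhood:
  assumes T: "openin (weak_star Z) T" and \<mu>: "\<mu> \<in> T"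
  obtains F e where "finite F" "\<And>f. f \<in> F \<Longrightarrow> continuous_map Z euclideanreal f" "e > 0"
    "\<And>\<nu>. \<nu> \<in> Mc Z \<Longrightarrow> \<forall>f\<in>F. \<bar>signed_integral Z \<nu> f - signed_integral Z \<mu> f\<bar> < e \<Longrightarrow> \<nu> \<in> T"
proof -
  let ?C = "{f. continuous_map Z euclideanreal f}"
  let ?I = "\<lambda>\<mu>. \<lambda>f\<in>?C. signed_integral Z \<mu> f"
  obtain U where U: "openin (product_topology (\<lambda>_. euclideanreal) ?C) U" and TU: "T = ?I -` U \<inter> Mc Z"
    using T unfolding weak_star_def openin_pullback_topology by blast
  have "?I \<mu> \<in> U" using \<mu> TU by blast
  from product_topology_open_contains_basis[OF U this] obtain X where
    X: "?I \<mu> \<in> PiE ?C X" "\<And>f. open (X f)" "finite {f. X f \<noteq> UNIV}" "PiE ?C X \<subseteq> U"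
    by auto
  define F where "F = {f \<in> ?C. X f \<noteq> UNIV}"
  have F: "finite F" unfolding F_def using X(3) by (rule rev_finite_subset) blast
  have "\<exists>e>0. \<forall>y. \<bar>y - signed_integral Z \<mu> f\<bar> < e \<longrightarrow> y \<in> X f" if "f \<in> F" for f
  proof -
    have "signed_integral Z \<mu> f \<in> X f" using X(1) that by (auto simp: F_def PiE_iff)
    with X(2)[of f] show ?thesis unfolding open_dist dist_real_def by blast
  qed
  then obtain d where d: "\<And>f. f \<in> F \<Longrightarrow> d f > 0"
    "\<And>f y. f \<in> F \<Longrightarrow> \<bar>y - signed_integral Z \<mu> f\<bar> < d f \<Longrightarrow> y \<in> X f" by metis
  \<comment> \<open>Inserting 1 keeps the minimum meaningful when \<open>F\<close> is empty.\<close>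
  define e where "e = Min (insert 1 (d ` F))"
  have e: "e > 0" "\<And>f. f \<in> F \<Longrightarrow> e \<le> d f"
    unfolding e_def using F d(1) by auto
  show ?thesis
  proof (rule that[OF F _ e(1)])
    fix \<nu> assume \<nu>: "\<nu> \<in> Mc Z" "\<forall>f\<in>F. \<bar>signed_integral Z \<nu> f - signed_integral Z \<mu> f\<bar> < e"
    have "signed_integral Z \<nu> f \<in> X f" if "f \<in> ?C" for f
    proof (cases "f \<in> F")
      case True
      then show ?thesis using bspec[OF \<nu>(2) True] e(2)[OF True] d(2)[OF True] by simp
    next
      case False
      then have "X f = UNIV" using that by (simp add: F_def)
      then show ?thesis by simp
    qed
    then have "?I \<nu> \<in> PiE ?C X" by simp
    then show "\<nu> \<in> T" using X(4) \<nu>(1) TU by blast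
  qed (simp add: F_def)
qed

subsection \<open>Linear forms continuous on dual balls\<close>

lemma linear_form_determined_by_dirac:
  assumes H: "Hausdorff_space Z" and \<phi>: "linear_form Z \<phi>"
    and cont: "\<And>K. compactin Z K \<Longrightarrow>
      continuous_map (subtopology (weak_star Z) (dual_ball Z K)) euclideanreal \<phi>"
    and f: "continuous_map Z euclideanreal f"
    and f\<phi>: "\<And>x. x \<in> topspace Z \<Longrightarrow> \<phi> (dirac Z x) = f x"
    and \<mu>: "\<mu> \<in> Mc Z"
  shows "\<phi> \<mu> = signed_integral Z \<mu> f"
proof -
  text \<open>After rescaling \<open>\<mu>\<close> into the dual ball of its support, sums of point masses in that same ball
    approximate it weakly, and the two forms agree on point masses.\<close>
  note I = linear_form_signed_integral[OF H]
  define K where "K = msupport Z \<mu>"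
  have K: "compactin Z K" unfolding K_def by (rule McD(3)[OF \<mu> H])
  have KT: "K \<subseteq> topspace Z" using K by (rule compactin_subset_topspace)
  text \<open>The summand 1 avoids a division by zero when \<open>\<mu> = 0\<close>.\<close>
  define r where "r = enn2real (tv_norm Z \<mu>) + 1"
  have r: "r > 0" by (simp add: r_def add_nonneg_pos)
  define \<mu>' where "\<mu>' = (\<lambda>A. inverse r * \<mu> A)"
  have \<mu>'M: "\<mu>' \<in> Mc Z" unfolding \<mu>'_def by (rule Mc_scale[OF \<mu> H])
  have \<mu>'K: "msupport Z \<mu>' \<subseteq> K" unfolding \<mu>'_def K_def by (rule msupport_scale)
  have \<mu>'1: "tv_norm Z \<mu>' \<le> 1"
  proof -
    have fin: "tv_norm Z \<mu> < top" using McD(4)[OF \<mu> H] by (simp add: tv_norm_def)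
    have "tv_norm Z \<mu>' \<le> ennreal \<bar>inverse r\<bar> * tv_norm Z \<mu>"
      unfolding tv_norm_def \<mu>'_def by (rule total_variation_scale_le)
    also have "\<dots> = ennreal (inverse r) * ennreal (enn2real (tv_norm Z \<mu>))"
      using r fin by simp
    also have "\<dots> = ennreal (inverse r * enn2real (tv_norm Z \<mu>))"
      using r by (intro ennreal_mult[symmetric]) simp_all
    also have "\<dots> \<le> ennreal 1"
      using r by (intro ennreal_leI) (simp add: r_def field_simps)
    finally show ?thesis by simp
  qed
  have ball: "\<mu>' \<in> dual_ball Z K" using \<mu>'M \<mu>'K \<mu>'1 by (simp add: dual_ball_def)
  let ?h = "\<lambda>\<nu>. \<phi> \<nu> - signed_integral Z \<nu> f"
  have "?h \<mu>' = 0"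
  \<comment> \<open>The points of the ball where \<open>?h\<close> is non-zero form a relatively
    open set. If \<mu>' belonged to it, so would some combination of point masses close to \<mu>',
    but \<open>?h\<close> vanishes at such combinations.\<close>
  proof (rule ccontr)
    assume ne: "?h \<mu>' \<noteq> 0"
    let ?S = "subtopology (weak_star Z) (dual_ball Z K)"
    have "continuous_map ?S euclideanreal ?h"
      by (rule continuous_map_diff[OF cont[OF K]
            continuous_map_from_subtopology[OF continuous_map_signed_integral[OF f]]])
    moreover have "openin euclideanreal (- {0})" by (simp add: open_Compl)
    ultimately have "openin ?S {\<nu> \<in> topspace ?S. ?h \<nu> \<in> - {0}}"
      by (rule openin_continuous_map_preimage)
    then obtain T where T: "openin (weak_star Z) T"
      "{\<nu> \<in> topspace ?S. ?h \<nu> \<in> - {0}} = T \<inter> dual_ball Z K"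
      unfolding openin_subtopology by blast
    have tS: "topspace ?S = dual_ball Z K" by (auto simp: dual_ball_def)
    have "\<mu>' \<in> {\<nu> \<in> topspace ?S. ?h \<nu> \<in> - {0}}" using ne ball unfolding tS by simp
    then have "\<mu>' \<in> T" unfolding T(2) by simp
    obtain F e where F: "finite F" "\<And>g. g \<in> F \<Longrightarrow> continuous_map Z euclideanreal g" "e > 0"
      and nbhd: "\<And>\<nu>. \<nu> \<in> Mc Z \<Longrightarrow>
        \<forall>g\<in>F. \<bar>signed_integral Z \<nu> g - signed_integral Z \<mu>' g\<bar> < e \<Longrightarrow> \<nu> \<in> T"
      by (rule weak_star_neighbourhood[OF T(1) \<open>\<mu>' \<in> T\<close>]) (rule that)
    \<comment> \<open>Oscillation \<open>e / 2\<close> leaves room for the strict bound that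
      \<open>nbhd\<close> asks for.\<close>
    have e2: "e / 2 > 0" using F(3) by simp
    obtain P where P: "finite P" "P \<subseteq> sets (borel_on Z)" "disjoint P" "\<Union>P = K" "{} \<notin> P"
      "\<And>B x y g. B \<in> P \<Longrightarrow> x \<in> B \<Longrightarrow> y \<in> B \<Longrightarrow> g \<in> F \<Longrightarrow> \<bar>g x - g y\<bar> \<le> e / 2"
      by (rule fine_partition[OF H K F(1) F(2) e2]) (assumption, rule that)
    define x where "x B = (SOME y. y \<in> B)" for B :: "'a set"
    have xB: "x B \<in> B" if "B \<in> P" for B
    proof -
      have "B \<noteq> {}" using P(5) that by blast
      then show ?thesis unfolding x_def by (simp add: some_in_eq)
    qed
    have xK: "x B \<in> K" if "B \<in> P" for B using xB[OF that] that P(4) by blast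
    \<comment> \<open>The mass of each cell is moved to its chosen point. Integrals against \<nu>
      are then exactly the step sums that approximate integrals against \<mu>'.\<close>
    define \<nu> where "\<nu> = (\<lambda>A. \<Sum>B\<in>P. \<mu>' B * dirac Z (x B) A)"
    have \<nu>: "\<nu> \<in> Mc Z" "msupport Z \<nu> \<subseteq> K" "tv_norm Z \<nu> \<le> (\<Sum>B\<in>P. ennreal \<bar>\<mu>' B\<bar>)"
      using dirac_combination(1-3)[where c = \<mu>' and x = x, OF H K P(1) xK] by (simp_all add: \<nu>_def)
    \<comment> \<open>Stated for arbitrary forms because it is applied both to \<phi> and to
      integration of a continuous function.\<close>
    have \<nu>lin: "\<psi> \<nu> = (\<Sum>B\<in>P. \<mu>' B * \<psi> (dirac Z (x B)))" if "linear_form Z \<psi>" for \<psi>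
      unfolding \<nu>_def using xK by (intro dirac_combination(4)[OF H K P(1) _ that])
    have I\<nu>: "signed_integral Z \<nu> g = (\<Sum>B\<in>P. g (x B) * \<mu>' B)" if g: "continuous_map Z euclideanreal g" for g
    proof -
      have "signed_integral Z \<nu> g = (\<Sum>B\<in>P. \<mu>' B * signed_integral Z (dirac Z (x B)) g)"
        by (rule \<nu>lin[OF I[OF g]])
      also have "\<dots> = (\<Sum>B\<in>P. g (x B) * \<mu>' B)"
        using xK KT by (intro sum.cong refl) (simp add: signed_integral_dirac[OF H _ g] subset_eq mult.commute)
      finally show ?thesis .
    qed
    have "\<nu> \<in> T"
    proof (rule nbhd[OF \<nu>(1)], rule ballI)
      fix g assume g: "g \<in> F"
      have "\<bar>signed_integral Z \<mu>' g - (\<Sum>B\<in>P. g (x B) * \<mu>' B)\<bar> \<le> e / 2 * enn2real (tv_norm Z \<mu>')"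
        by (rule Mc_signed_integral_approx[OF \<mu>'M H K \<mu>'K P(1-4) F(2)[OF g]])
           (rule P(6)[OF _ _ xB g])
      also have "\<dots> \<le> e / 2 * 1"
        using e2 enn2real_mono[OF \<mu>'1] by (intro mult_left_mono) simp_all
      also have "\<dots> < e" using F(3) by simp
      finally show "\<bar>signed_integral Z \<nu> g - signed_integral Z \<mu>' g\<bar> < e"
        by (simp add: I\<nu>[OF F(2)[OF g]] abs_minus_commute)
    qed
    moreover have "\<nu> \<in> dual_ball Z K"
    proof -
      \<comment> \<open>The cells form an admissible partition of \<open>K\<close>, so the sum of
        the absolute weights is at most the variation of \<mu>'. This keeps \<nu> in the ball on
        which \<phi> is known to be continuous.\<close>
      have "tv_norm Z \<nu> \<le> (\<Sum>B\<in>P. ennreal \<bar>\<mu>' B\<bar>)" by (rule \<nu>(3))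
      also have "\<dots> \<le> total_variation Z \<mu>' K" by (rule total_variation_upper[OF P(1-4)])
      also have "\<dots> \<le> tv_norm Z \<mu>'" unfolding tv_norm_def using KT by (intro total_variation_mono) simp_all
      also note \<mu>'1
      finally show ?thesis using \<nu>(1,2) by (simp add: dual_ball_def)
    qed
    ultimately have "\<nu> \<in> {\<nu> \<in> topspace ?S. ?h \<nu> \<in> - {0}}" unfolding T(2) by simp
    then have "?h \<nu> \<noteq> 0" by simp
    moreover have "\<phi> \<nu> = (\<Sum>B\<in>P. \<mu>' B * \<phi> (dirac Z (x B)))" by (rule \<nu>lin[OF \<phi>])
    then have "\<phi> \<nu> = (\<Sum>B\<in>P. f (x B) * \<mu>' B)"
      using xK KT f\<phi> by (simp add: subset_eq mult.commute)
    ultimately show False using I\<nu>[OF f] by simp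
  qed
  moreover have "\<mu> = (\<lambda>A. r * \<mu>' A)" using r by (simp add: \<mu>'_def fun_eq_iff flip: mult.assoc)
  then have "\<phi> \<mu> = r * \<phi> \<mu>'" "signed_integral Z \<mu> f = r * signed_integral Z \<mu>' f"
    using linear_formD(2)[OF \<phi> \<mu>'M] linear_formD(2)[OF I[OF f] \<mu>'M] by simp_all
  ultimately show ?thesis by simp
qed

text \<open>Weak-star continuity restricts to every dual ball, and it makes the composite of \<phi>
  with the continuous map \<open>dirac Z\<close> continuous; this composite is the representing
  function.\<close>

lemma linear_form_representation:
  assumes H: "Hausdorff_space Z" and \<phi>: "linear_form Z \<phi>"
    and cont: "continuous_map (weak_star Z) euclideanreal \<phi>"
  shows "\<exists>f. continuous_map Z euclideanreal f \<and> (\<forall>\<mu>\<in>Mc Z. \<phi> \<mu> = signed_integral Z \<mu> f)"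
proof (intro exI conjI ballI)
  show f: "continuous_map Z euclideanreal (\<phi> \<circ> dirac Z)"
    by (rule continuous_map_compose[OF continuous_map_dirac[OF H] cont])
  show "\<phi> \<mu> = signed_integral Z \<mu> (\<phi> \<circ> dirac Z)" if "\<mu> \<in> Mc Z" for \<mu>
    by (rule linear_form_determined_by_dirac[OF H \<phi> continuous_map_from_subtopology[OF cont] f _ that]) simp
qed

lemma continuous_map_represented:
  assumes "continuous_map Z euclideanreal f" "\<And>\<mu>. \<mu> \<in> Mc Z \<Longrightarrow> \<phi> \<mu> = signed_integral Z \<mu> f"
  shows "continuous_map (weak_star Z) euclideanreal \<phi>"
  using assms(2) by (intro continuous_map_eq[OF continuous_map_signed_integral[OF assms(1)]]) simp

section \<open>The two implications of the equivalence\<close>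

lemma kR_space_imp_weak_star_continuous:
  assumes H: "Hausdorff_space Z" and kR: "kR_space Z" and \<phi>: "linear_form Z \<phi>"
    and cont: "\<And>K. compactin Z K \<Longrightarrow>
      continuous_map (subtopology (weak_star Z) (dual_ball Z K)) euclideanreal \<phi>"
  shows "continuous_map (weak_star Z) euclideanreal \<phi>"
proof (rule continuous_map_represented)
  have "k_continuous Z (\<phi> \<circ> dirac Z)"
    unfolding k_continuous_def
  proof (intro allI impI)
    fix K assume K: "compactin Z K"
    \<comment> \<open>The map \<open>dirac Z\<close> sends \<open>K\<close> into its dual ball, so
      continuity of \<phi> on that ball is enough for continuity of the composite on
      \<open>K\<close>.\<close>
    have "dirac Z x \<in> dual_ball Z K" if "x \<in> topspace (subtopology Z K)" for x
      using that dirac_Mc[OF H, of x] tv_norm_dirac_le[of Z x] by (auto simp: dual_ball_def)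
    then have "continuous_map (subtopology Z K) (subtopology (weak_star Z) (dual_ball Z K)) (dirac Z)"
      using continuous_map_from_subtopology[OF continuous_map_dirac[OF H]]
      by (auto simp: continuous_map_in_subtopology)
    then show "continuous_map (subtopology Z K) euclideanreal (\<phi> \<circ> dirac Z)"
      using cont[OF K] by (rule continuous_map_compose)
  qed
  \<comment> \<open>Here the k-continuous function becomes continuous on all of
    \<open>Z\<close>.\<close>
  then show f: "continuous_map Z euclideanreal (\<phi> \<circ> dirac Z)"
    using kR unfolding kR_space_def by blast
  show "\<phi> \<mu> = signed_integral Z \<mu> (\<phi> \<circ> dirac Z)" if "\<mu> \<in> Mc Z" for \<mu>
    by (rule linear_form_determined_by_dirac[OF H \<phi> cont f _ that]) simp_all
qed

lemma weak_star_continuous_imp_kR_space: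
  fixes Z :: "'a topology"
  assumes Z: "tychonoff_space Z"
    and cont: "\<And>\<phi>. linear_form Z \<phi> \<Longrightarrow>
      (\<And>K. compactin Z K \<Longrightarrow>
        continuous_map (subtopology (weak_star Z) (dual_ball Z K)) euclideanreal \<phi>) \<Longrightarrow>
      continuous_map (weak_star Z) euclideanreal \<phi>"
  shows "kR_space Z"
  unfolding kR_space_def
proof (intro allI impI)
  fix f assume f: "k_continuous Z f"
  have H: "Hausdorff_space Z" and cr: "completely_regular_space Z"
    using Z by (simp_all add: tychonoff_space_def)
  \<comment> \<open>In a completely regular space a continuous real function on a compact set
    extends to the whole space. The extension may depend on the compact set, as \<open>f\<close>
    itself is not known to be continuous.\<close>
  have "\<exists>g. continuous_map Z euclideanreal g \<and> (\<forall>x\<in>K. g x = f x)" if K: "compactin Z K" for K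
  proof -
    have "continuous_map (subtopology Z K) euclideanreal f"
      using f K unfolding k_continuous_def by blast
    then obtain g where "continuous_map Z euclideanreal g" "\<And>x. x \<in> K \<Longrightarrow> g x = f x"
      by (rule Tietze_extension_completely_regular[OF cr K is_interval_univ UNIV_not_empty _ subset_UNIV]) (rule that)
    then show ?thesis by blast
  qed
  then obtain E where E: "\<And>K. compactin Z K \<Longrightarrow> continuous_map Z euclideanreal (E K)"
    "\<And>K x. compactin Z K \<Longrightarrow> x \<in> K \<Longrightarrow> E K x = f x" by metis
  \<comment> \<open>This is formally the integral of \<open>f\<close>. Since \<open>f\<close> may
    fail to be continuous, it is replaced by an extension from the support, which varies with the
    measure.\<close>
  define \<phi> where "\<phi> \<mu> = signed_integral Z \<mu> (E (msupport Z \<mu>))" for \<mu>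
  \<comment> \<open>Any compact set containing the support gives the same value, because both
    extensions agree with \<open>f\<close> on the support. This lets several measures be treated
    with one common integrand.\<close>
  have \<phi>: "\<phi> \<mu> = signed_integral Z \<mu> (E K)"
    if "\<mu> \<in> Mc Z" "compactin Z K" "msupport Z \<mu> \<subseteq> K" for \<mu> K
  proof -
    note s = McD(3)[OF that(1) H]
    show ?thesis
      unfolding \<phi>_def using that(3) E(2)[OF s] E(2)[OF that(2)]
      by (intro signed_integral_cong_support[OF that(1) H E(1)[OF that(2)] E(1)[OF s]]) auto
  qed
  have "linear_form Z \<phi>"
    unfolding linear_form_def
  proof (intro conjI ballI allI)
    fix \<mu> \<nu> assume M: "\<mu> \<in> Mc Z" "\<nu> \<in> Mc Z"
    \<comment> \<open>The three supports involved all lie in this union, so additivity reduces to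
      that of integrating one continuous function.\<close>
    let ?K = "msupport Z \<mu> \<union> msupport Z \<nu>"
    have K: "compactin Z ?K" using McD(3)[OF M(1) H] McD(3)[OF M(2) H] by (rule compactin_Un)
    show "\<phi> (\<lambda>A. \<mu> A + \<nu> A) = \<phi> \<mu> + \<phi> \<nu>"
      using \<phi>[OF Mc_add[OF M H] K msupport_add] \<phi>[OF M(1) K Un_upper1] \<phi>[OF M(2) K Un_upper2]
        signed_integral_add[OF M H E(1)[OF K]] by simp
  next
    fix c \<mu> assume M: "\<mu> \<in> Mc Z"
    note K = McD(3)[OF M H]
    show "\<phi> (\<lambda>A. c * \<mu> A) = c * \<phi> \<mu>"
      using \<phi>[OF Mc_scale[OF M H] K msupport_scale] \<phi>[OF M K order_refl]
        signed_integral_scale[OF M H E(1)[OF K]] by simp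
  qed
  \<comment> \<open>All measures in one ball are supported in the same \<open>K\<close>, so on that
    ball \<phi> is integration of the single continuous function \<open>E K\<close>.\<close>
  moreover have "continuous_map (subtopology (weak_star Z) (dual_ball Z K)) euclideanreal \<phi>"
    if K: "compactin Z K" for K
  proof (rule continuous_map_eq)
    show "continuous_map (subtopology (weak_star Z) (dual_ball Z K)) euclideanreal
        (\<lambda>\<mu>. signed_integral Z \<mu> (E K))"
      by (intro continuous_map_from_subtopology continuous_map_signed_integral E(1) K)
  qed (use \<phi>[OF _ K] in \<open>auto simp: dual_ball_def\<close>)
  ultimately have "continuous_map (weak_star Z) euclideanreal \<phi>" by (rule cont)
  from continuous_map_compose[OF continuous_map_dirac[OF H] this]
  have "continuous_map Z euclideanreal (\<phi> \<circ> dirac Z)" .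
  then show "continuous_map Z euclideanreal f"
  proof (rule continuous_map_eq)
    fix x assume x: "x \<in> topspace Z"
    then have K: "compactin Z {x}" by simp
    \<comment> \<open>On the support of the point mass the integrand may be taken to be
      \<open>E {x}\<close>, whose value at \<open>x\<close> is \<open>f x\<close>.\<close>
    show "(\<phi> \<circ> dirac Z) x = f x"
      using \<phi>[OF dirac_Mc(1)[OF H x] K dirac_Mc(2)[OF H x]]
        signed_integral_dirac[OF H x E(1)[OF K]] E(2)[OF K] by simp
  qed
qed

text \<open>The second conjunct justifies reading weak-star continuity of a linear form as
  membership in C(Z).\<close>

theorem theorem5p1:
  fixes Z :: "'a topology"
  assumes "tychonoff_space Z"
  shows "(kR_space Z \<longleftrightarrow>
           (\<forall>\<phi>. linear_form Z \<phi> \<and>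
                (\<forall>K. compactin Z K \<longrightarrow>
                   continuous_map (subtopology (weak_star Z) (dual_ball Z K)) euclideanreal \<phi>)
              \<longrightarrow> continuous_map (weak_star Z) euclideanreal \<phi>))
       \<and> (\<forall>\<phi>. linear_form Z \<phi> \<longrightarrow>
            (continuous_map (weak_star Z) euclideanreal \<phi> \<longleftrightarrow>
              (\<exists>f. continuous_map Z euclideanreal f \<and>
                   (\<forall>\<mu>\<in>Mc Z. \<phi> \<mu> = signed_integral Z \<mu> f))))"
proof -
  have H: "Hausdorff_space Z" using assms by (simp add: tychonoff_space_def)
  show ?thesis
  proof (intro conjI iffI allI impI)
    fix \<phi>
    assume "kR_space Z" and "linear_form Z \<phi> \<and> (\<forall>K. compactin Z K \<longrightarrow>
      continuous_map (subtopology (weak_star Z) (dual_ball Z K)) euclideanreal \<phi>)"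
    then show "continuous_map (weak_star Z) euclideanreal \<phi>"
      by (intro kR_space_imp_weak_star_continuous[OF H]) simp_all
  next
    assume "\<forall>\<phi>. linear_form Z \<phi> \<and> (\<forall>K. compactin Z K \<longrightarrow>
        continuous_map (subtopology (weak_star Z) (dual_ball Z K)) euclideanreal \<phi>)
      \<longrightarrow> continuous_map (weak_star Z) euclideanreal \<phi>"
    then show "kR_space Z"
      by (intro weak_star_continuous_imp_kR_space[OF assms]) simp
  next
    fix \<phi> assume "linear_form Z \<phi>" "continuous_map (weak_star Z) euclideanreal \<phi>"
    then show "\<exists>f. continuous_map Z euclideanreal f \<and> (\<forall>\<mu>\<in>Mc Z. \<phi> \<mu> = signed_integral Z \<mu> f)"
      by (rule linear_form_representation[OF H])
  next
    fix \<phi> assume "\<exists>f. continuous_map Z euclideanreal f \<and> (\<forall>\<mu>\<in>Mc Z. \<phi> \<mu> = signed_integral Z \<mu> f)"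
    then show "continuous_map (weak_star Z) euclideanreal \<phi>"
      using continuous_map_represented by blast
  qed
qed

end
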